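(* Fix $0<p<2$. For $t>0$ let $\hat\mu_t$ be the thresholding estimator with coordinates $\hat\mu_{t,i}=X_i$ if $X_i\ge t$ and $\hat\mu_{t,i}=1$ otherwise. Then $$\liminf_{\eta\to 0}\ \inf_{t}\left[\lim_{n\to\infty}\frac{\sup_{\mu\in M_{n,p}(\eta)}R_n(\hat\mu_t,\mu)}{R_n^*(M_{n,p}(\eta))}\right]=1.$$
   Context: Observations: $X_1,\dots,X_n$ independent with $X_i\sim\mathrm{Exp}(\mu_i)$ (exponential with mean $\mu_i$), where $\mu=(\mu_1,\dots,\mu_n)$ is deterministic with all $\mu_i\ge1$. $M_{n,p}(\eta)=\{\mu\in[1,\infty)^n:\frac1n\sum_{i=1}^n\log^p(\mu_i)\le\eta^p\}$. For an estimator $\hat\mu$ with values in $(0,\infty)^n$, $R_n(\hat\mu,\mu)=\mathbb{E}_\mu\big[\frac1n\sum_{i=1}^n(\log\hat\mu_i-\log\mu_i)^2\big]$, and $R_n^*(M_{n,p}(\eta))=\inf_{\hat\mu}\sup_{\mu\in M_{n,p}(\eta)}R_n(\hat\mu,\mu)$ is the minimax risk over all estimators. The threshold $t$ may depend on $p,\eta$ but not on $n$. *)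

theory Defs
  imports "HOL-Probability.Probability"
begin

definition obs_law :: "nat \<Rightarrow> (nat \<Rightarrow> real) \<Rightarrow> (nat \<Rightarrow> real) measure" where
  "obs_law n \<mu> = PiM {..<n} (\<lambda>i. density lborel (exponential_density (1 / \<mu> i)))"

definition param_set :: "nat \<Rightarrow> real \<Rightarrow> real \<Rightarrow> (nat \<Rightarrow> real) set" where
  "param_set n p \<eta> = {\<mu>. (\<forall>i<n. 1 \<le> \<mu> i) \<and>
      (1 / real n) * (\<Sum>i<n. (ln (\<mu> i)) powr p) \<le> \<eta> powr p}"

definition estimators :: "nat \<Rightarrow> ((nat \<Rightarrow> real) \<Rightarrow> nat \<Rightarrow> real) set" where
  "estimators n = {f. (\<forall>i<n. (\<lambda>x. f x i) \<in> borel_measurable (PiM {..<n} (\<lambda>_. borel))) \<and>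
      (\<forall>x. \<forall>i<n. 0 < f x i)}"

definition risk :: "nat \<Rightarrow> ((nat \<Rightarrow> real) \<Rightarrow> nat \<Rightarrow> real) \<Rightarrow> (nat \<Rightarrow> real) \<Rightarrow> ennreal" where
  "risk n f \<mu> = (\<integral>\<^sup>+ x. ennreal ((1 / real n) * (\<Sum>i<n. (ln (f x i) - ln (\<mu> i))^2)) \<partial>obs_law n \<mu>)"

definition max_risk :: "nat \<Rightarrow> real \<Rightarrow> real \<Rightarrow> ((nat \<Rightarrow> real) \<Rightarrow> nat \<Rightarrow> real) \<Rightarrow> ennreal" where
  "max_risk n p \<eta> f = (SUP \<mu>\<in>param_set n p \<eta>. risk n f \<mu>)"

definition minimax_risk :: "nat \<Rightarrow> real \<Rightarrow> real \<Rightarrow> ennreal" where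
  "minimax_risk n p \<eta> = (INF f\<in>estimators n. max_risk n p \<eta> f)"

definition thresh_est :: "real \<Rightarrow> (nat \<Rightarrow> real) \<Rightarrow> nat \<Rightarrow> real" where
  "thresh_est t x i = (if t \<le> x i then x i else 1)"

end

theory Submission
  imports Defs "HOL-Real_Asymp.Real_Asymp"
begin

text \<open>
  On the logarithmic scale the observations are \<open>\<theta>\<^sub>i\<close> plus noise whose right tail is doubly exponentially
  small, so that a spike hidden among \<open>\<eta>\<close>-sparse coordinates is invisible as long as
  \<open>\<theta>\<close> is below about \<open>ln (ln (1 / \<eta>))\<close> and obvious above that level.  Hence both risks behave like
  \<open>\<eta>\<^sup>p (ln (ln (1 / \<eta>)))\<^bsup>2 - p\<^esup>\<close>: the upper bound comes from the threshold
  \<open>2 e p ln (1 / \<eta>)\<close>, the lower bound from a single spike at a uniformly chosen coordinate in a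
  block of about \<open>\<theta>\<^sup>p / \<eta>\<^sup>p\<close> coordinates.

  The limits in \<open>n\<close> exist by Fekete's argument.  The total worst-case risk of a coordinatewise
  estimator is superadditive in \<open>n\<close>, since parameters can be concatenated.  The minimax risk is not
  obviously superadditive, but the Bayes value (the supremum of Bayes risks over finitely supported
  priors) is, by taking product priors, and a minimax theorem identifies the two in the limit.
\<close>

section \<open>Superadditive sequences and finite games\<close>

text \<open>If X is exponential with mean 1, then ln X exceeds s with probability exp (- exp s). A
  threshold t therefore keeps a coordinate without signal with probability exp (- t), while a spike
  of height \<theta> is missed with probability at most exp (ln t - \<theta>). The threshold enters
  the main term only through ln t, so constant factors in t vanish in the ratio, and crude estimates
  of the false alarms still give the sharp constant. For the lower bound the spike height is (1 -
  \<delta>) ln y with y = ln (1 / \<eta>), a fixed fraction of the detection level. On the relevant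
  event the likelihood ratio is then at most exp (y powr (1 - \<delta> / 2)), negligible against a
  block size of order exp (p y). Every point of this prior meets the budget exactly as required, not
  just on average, and the limiting minimax risk dominates the Bayes risk per coordinate of any one
  block size, so a block depending on \<eta> alone suffices. The two bounds differ by the factor (1
  - \<delta>) powr (p - 2), and \<delta> tends to 0 last.\<close>

lemma superadditive_limit:
  fixes a :: "nat \<Rightarrow> real"
  assumes super: "\<And>m n. a m + a n \<le> a (m + n)"
    and nonneg: "\<And>n. 0 \<le> a n" and bound: "\<And>n. a n \<le> C * real n"
  shows "(\<lambda>n. a n / real n) \<longlonglongrightarrow> (SUP n\<in>{1..}. a n / real n)"
proof (rule order_tendstoI)
  have bdd: "bdd_above ((\<lambda>n. a n / real n) ` {1..})"
    using bound by (intro bdd_aboveI2[where M = C]) (auto simp: divide_simps)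
  fix y
  {
    assume "y < (SUP n\<in>{1..}. a n / real n)"
    then obtain m where m: "m \<ge> 1" "y < a m / real m"
      using less_cSUP_iff[OF _ bdd] by auto
    have mult: "real q * a m \<le> a (q * m)" for q
    proof (induction q)
      case 0 then show ?case using nonneg by simp
    next
      case (Suc q) then show ?case using super[of m "q * m"] by (simp add: algebra_simps)
    qed
    \<comment> \<open>Division with remainder: n consists of \<open>n div m\<close> blocks of length
      m and a remainder whose value is dropped by nonnegativity.\<close>
    have low: "(1 - real m / real n) * (a m / real m) \<le> a n / real n" if n: "n \<ge> 1" for n
    proof -
      have "real n - real m \<le> real (n div m) * real m"
      proof -
        have "n \<le> n div m * m + m"
          using m(1) by (metis add_left_mono div_mult_mod_eq mod_le_divisor less_eq_Suc_le One_nat_def)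
        then show ?thesis by (metis diff_le_eq of_nat_add of_nat_mono of_nat_mult)
      qed
      then have "(real n - real m) * (a m / real m) \<le> real (n div m) * real m * (a m / real m)"
        using nonneg by (intro mult_right_mono) auto
      also have "\<dots> = real (n div m) * a m" using m by simp
      also have "\<dots> \<le> a (n div m * m)" by (rule mult)
      also have "\<dots> \<le> a n"
        using super[of "n div m * m" "n mod m"] nonneg[of "n mod m"] by simp
      finally have "(real n - real m) * (a m / real m) / real n \<le> a n / real n"
        by (rule divide_right_mono) simp
      then show ?thesis using n m by (simp add: divide_simps split: if_splits)
    qed
    have "(\<lambda>n. (1 - real m / real n) * (a m / real m)) \<longlonglongrightarrow> (1 - 0) * (a m / real m)"
      by (intro tendsto_intros lim_const_over_n)
    then have "\<forall>\<^sub>F n in sequentially. y < (1 - real m / real n) * (a m / real m)"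
      using m by (intro order_tendstoD) auto
    then show "\<forall>\<^sub>F n in sequentially. y < a n / real n"
      using eventually_ge_at_top[of 1] by eventually_elim (use low in fastforce)
  }
  {
    assume *: "(SUP n\<in>{1..}. a n / real n) < y"
    show "\<forall>\<^sub>F n in sequentially. a n / real n < y"
      using eventually_ge_at_top[of 1]
      by eventually_elim (use cSUP_upper[OF _ bdd] * in fastforce)
  }
qed

text \<open>The sum of the squared excess risks decreases by a fixed amount when one moves from any strategy
  towards a best reply to the prior proportional to its excess risks, so its infimum is zero.\<close>

lemma finite_minimax:
  fixes r :: "'f \<Rightarrow> 'm \<Rightarrow> real"
  assumes fin: "finite F" and ne: "E \<noteq> {}"
    and bounds: "\<And>f m. f \<in> E \<Longrightarrow> m \<in> F \<Longrightarrow> 0 \<le> r f m \<and> r f m \<le> C"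
    and mix: "\<And>f g \<alpha>. f \<in> E \<Longrightarrow> g \<in> E \<Longrightarrow> 0 \<le> \<alpha> \<Longrightarrow> \<alpha> \<le> 1 \<Longrightarrow>
      \<exists>h\<in>E. \<forall>m\<in>F. r h m \<le> (1 - \<alpha>) * r f m + \<alpha> * r g m"
    and bayes: "\<And>w. (\<forall>m\<in>F. 0 \<le> w m) \<Longrightarrow> sum w F = 1 \<Longrightarrow> \<exists>g\<in>E. (\<Sum>m\<in>F. w m * r g m) \<le> c"
    and e: "0 < e"
  shows "\<exists>f\<in>E. \<forall>m\<in>F. r f m \<le> c + e"
proof (rule ccontr)
  assume "\<not> ?thesis"
  then have contra: "\<exists>m\<in>F. r f m > c + e" if "f \<in> E" for f using that by (meson not_le)
  \<comment> \<open>The level halfway between c and c + e leaves e / 2 on both sides: the assumed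
    worst excess is at least e / 2, and a best reply lies e / 2 below the level on average.\<close>
  define x where "x f m = max 0 (r f m - (c + e / 2))" for f m
  define \<Phi> where "\<Phi> f = (\<Sum>m\<in>F. (x f m)\<^sup>2)" for f
  \<comment> \<open>The potential changes by at most - \<alpha> e^2 / 2 + \<alpha>^2 Q, and
    \<open>\<alpha>\<close> is the minimiser of this quadratic. The summand e^2 in \<open>Q\<close>
    makes \<open>Q\<close> positive and \<open>\<alpha>\<close> at most 1.\<close>
  define Q where "Q = real (card F) * C\<^sup>2 + e\<^sup>2"
  define \<alpha> where "\<alpha> = e\<^sup>2 / (4 * Q)"
  have Q: "Q > 0" "real (card F) * C\<^sup>2 \<le> Q" "e\<^sup>2 \<le> Q"
    using e unfolding Q_def by (auto intro: add_nonneg_pos)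
  have \<alpha>: "0 < \<alpha>" "\<alpha> \<le> 1" using Q e by (auto simp: \<alpha>_def)
  have step: "\<exists>h\<in>E. \<Phi> h \<le> \<Phi> f - \<alpha> * e\<^sup>2 / 4" if f: "f \<in> E" for f
  proof -
    define W where "W = (\<Sum>m\<in>F. x f m)"
    obtain m where m: "m \<in> F" "r f m > c + e" using contra f by blast
    have "e / 2 \<le> x f m" using m e by (simp add: x_def max_def field_simps)
    also have "\<dots> \<le> W" unfolding W_def
      using member_le_sum[OF m(1), of "x f"] fin by (auto simp: x_def)
    finally have W: "e / 2 \<le> W" .
    have "\<exists>g\<in>E. (\<Sum>m\<in>F. x f m / W * r g m) \<le> c"
      using W e by (intro bayes) (auto simp: x_def W_def sum_divide_distrib[symmetric])
    then obtain g where g: "g \<in> E" "(\<Sum>m\<in>F. x f m / W * r g m) \<le> c" by blast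
    have "(\<Sum>m\<in>F. x f m * r g m) = W * (\<Sum>m\<in>F. x f m / W * r g m)"
      using W e by (simp add: sum_distrib_left)
    also have "\<dots> \<le> W * c" using g W e by (intro mult_left_mono) auto
    finally have g2: "(\<Sum>m\<in>F. x f m * r g m) \<le> W * c" .
    obtain h where h: "h \<in> E" "\<forall>m\<in>F. r h m \<le> (1 - \<alpha>) * r f m + \<alpha> * r g m"
      using mix[OF f g(1)] \<alpha> by (meson less_imp_le)
    have "\<Phi> h \<le> (\<Sum>m\<in>F. (x f m)\<^sup>2 + 2 * \<alpha> * (x f m * r g m - x f m * (c + e / 2)) + \<alpha>\<^sup>2 * C\<^sup>2)"
      unfolding \<Phi>_def
    proof (rule sum_mono)
      fix m assume m: "m \<in> F"
      define v where "v = r f m - (c + e / 2)"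
      define d where "d = r g m - r f m"
      have d: "d\<^sup>2 \<le> C\<^sup>2" using bounds[OF f m] bounds[OF g(1) m]
        by (intro power2_le_iff_abs_le[THEN iffD2]) (auto simp: d_def)
      have hb: "x h m \<le> max 0 (v + \<alpha> * d)"
        using h(2) m by (auto simp: x_def v_def d_def algebra_simps)
      have "(x h m)\<^sup>2 \<le> (max 0 (v + \<alpha> * d))\<^sup>2"
        using hb by (intro power_mono) (auto simp: x_def)
      \<comment> \<open>The squared positive part has a Lipschitz derivative, so its first-order
        expansion at v is a global upper bound once the full quadratic remainder is added.\<close>
      also have "\<dots> \<le> (max 0 v)\<^sup>2 + 2 * \<alpha> * (max 0 v * d) + \<alpha>\<^sup>2 * d\<^sup>2"
      proof (cases "v \<ge> 0")
        case True
        have "(max 0 (v + \<alpha> * d))\<^sup>2 \<le> (v + \<alpha> * d)\<^sup>2" by (auto simp: max_def)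
        then show ?thesis using True by (simp add: power2_sum power_mult_distrib algebra_simps)
      next
        case False
        then have "\<bar>max 0 (v + \<alpha> * d)\<bar> \<le> \<bar>\<alpha> * d\<bar>" by auto
        then have "(max 0 (v + \<alpha> * d))\<^sup>2 \<le> (\<alpha> * d)\<^sup>2" by (simp only: abs_le_square_iff)
        then show ?thesis using False by (simp add: power_mult_distrib)
      qed
      also have "max 0 v * d = max 0 v * r g m - max 0 v * (c + e / 2) - max 0 v * v"
        by (simp add: v_def d_def algebra_simps)
      also have "(max 0 v)\<^sup>2 + 2 * \<alpha> * (max 0 v * r g m - max 0 v * (c + e / 2) - max 0 v * v) + \<alpha>\<^sup>2 * d\<^sup>2
          \<le> (max 0 v)\<^sup>2 + 2 * \<alpha> * (max 0 v * r g m - max 0 v * (c + e / 2)) + \<alpha>\<^sup>2 * C\<^sup>2"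
        using \<alpha> d by (intro add_mono mult_left_mono) (auto simp: max_def)
      finally show "(x h m)\<^sup>2 \<le> (x f m)\<^sup>2 + 2 * \<alpha> * (x f m * r g m - x f m * (c + e / 2)) + \<alpha>\<^sup>2 * C\<^sup>2"
        by (simp add: x_def v_def)
    qed
    also have "\<dots> = \<Phi> f + 2 * \<alpha> * ((\<Sum>m\<in>F. x f m * r g m) - W * (c + e / 2)) + \<alpha>\<^sup>2 * (real (card F) * C\<^sup>2)"
      by (simp add: \<Phi>_def W_def sum.distrib sum_subtractf sum_distrib_left sum_distrib_right algebra_simps)
    also have "\<dots> \<le> \<Phi> f + 2 * \<alpha> * (- (e\<^sup>2 / 4)) + \<alpha>\<^sup>2 * Q"
    proof -
      have "(\<Sum>m\<in>F. x f m * r g m) - W * (c + e / 2) \<le> - (W * (e / 2))" using g2 by (simp add: algebra_simps)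
      also have "\<dots> \<le> - (e / 2 * (e / 2))" using W e by (simp add: mult_right_mono)
      finally have "(\<Sum>m\<in>F. x f m * r g m) - W * (c + e / 2) \<le> - (e\<^sup>2 / 4)" by (simp add: power2_eq_square)
      then show ?thesis using Q \<alpha> by (intro add_mono mult_left_mono) auto
    qed
    also have "\<alpha>\<^sup>2 * Q = \<alpha> * e\<^sup>2 / 4" using Q by (simp add: \<alpha>_def power2_eq_square)
    finally show ?thesis using h(1) by (intro bexI[of _ h]) (auto simp: algebra_simps)
  qed
  have bdd: "bdd_below (\<Phi> ` E)" by (intro bdd_belowI2[where m = 0]) (auto simp: \<Phi>_def intro: sum_nonneg)
  \<comment> \<open>A strategy within one decrement of the infimum would be improved to below the
    infimum.\<close>
  have pos: "0 < \<alpha> * e\<^sup>2 / 4" using \<alpha> e by simp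
  then obtain f where f: "f \<in> E" "\<Phi> f < Inf (\<Phi> ` E) + \<alpha> * e\<^sup>2 / 4"
    using cINF_less_iff[OF ne bdd] by (metis less_add_same_cancel1)
  obtain h where "h \<in> E" "\<Phi> h \<le> \<Phi> f - \<alpha> * e\<^sup>2 / 4" using step f by blast
  then show False using cINF_lower[OF bdd, of h] f by auto
qed

section \<open>The law of the observations\<close>

lemma sets_obs_law [measurable_cong]: "sets (obs_law n \<mu>) = sets (PiM {..<n} (\<lambda>_. borel))"
  unfolding obs_law_def by (intro sets_PiM_cong) auto

lemma space_obs_law: "space (obs_law n \<mu>) = PiE {..<n} (\<lambda>_. UNIV)"
  unfolding obs_law_def by (simp add: space_PiM)

lemma obs_law_cong: "(\<And>i. i < n \<Longrightarrow> \<mu> i = \<nu> i) \<Longrightarrow> obs_law n \<mu> = obs_law n \<nu>"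
  unfolding obs_law_def by (intro PiM_cong) auto

lemma prob_space_exponential:
  "0 < \<mu> \<Longrightarrow> prob_space (density lborel (\<lambda>x. ennreal (exponential_density (1 / \<mu>) x)))"
  by (rule prob_space_exponential_density) simp

lemma prob_space_obs_law:
  assumes "\<And>i. i < n \<Longrightarrow> 1 \<le> \<mu> i"
  shows "prob_space (obs_law n \<mu>)"
  unfolding obs_law_def
  by (rule prob_space_PiM) (use assms prob_space_exponential less_le_trans in force)

lemma product_sigma_finite_exponential:
  assumes "\<And>i. 0 < \<mu> i"
  shows "product_sigma_finite (\<lambda>i::nat. density lborel (\<lambda>x. ennreal (exponential_density (1 / \<mu> i) x)))"
  using prob_space_exponential[OF assms]
  by (auto simp: product_sigma_finite_def intro: prob_space_imp_sigma_finite)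

lemma obs_law_component:
  assumes "\<And>i. i < n \<Longrightarrow> 1 \<le> \<mu> i" and i: "i < n" and [measurable]: "g \<in> borel_measurable borel"
  shows "(\<integral>\<^sup>+x. g (x i) \<partial>obs_law n \<mu>) = (\<integral>\<^sup>+x. g x \<partial>density lborel (\<lambda>x. ennreal (exponential_density (1 / \<mu> i) x)))"
proof -
  let ?M = "\<lambda>i. density lborel (\<lambda>x. ennreal (exponential_density (1 / \<mu> i) x))"
  have "distr (PiM {..<n} ?M) (?M i) (\<lambda>\<omega>. \<omega> i) = ?M i"
    by (rule distr_PiM_component) (use assms prob_space_exponential less_le_trans in force)+
  then have "(\<integral>\<^sup>+x. g x \<partial>?M i) = (\<integral>\<^sup>+x. g x \<partial>distr (PiM {..<n} ?M) (?M i) (\<lambda>\<omega>. \<omega> i))"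
    by simp
  also have "\<dots> = (\<integral>\<^sup>+x. g (x i) \<partial>PiM {..<n} ?M)"
    using i by (intro nn_integral_distr) auto
  finally show ?thesis by (simp add: obs_law_def)
qed

text \<open>A joint density with respect to one common measure is what allows the laws at two
  parameters to be compared pointwise, through their likelihood ratio.\<close>

lemma obs_law_eq_density:
  assumes pos: "\<And>i. i < n \<Longrightarrow> 1 \<le> \<mu> i"
  shows "obs_law n \<mu> = density (PiM {..<n} (\<lambda>_. lborel)) (\<lambda>x. \<Prod>i<n. ennreal (exponential_density (1 / \<mu> i) (x i)))"
proof -
  \<comment> \<open>\<open>product_sigma_finite\<close> speaks of all indices, so the parameter is
    made positive beyond n as well.\<close>
  define \<nu> where "\<nu> i = (if i < n then \<mu> i else 1)" for i
  have \<nu>: "0 < \<nu> i" for i using pos[of i] by (auto simp: \<nu>_def)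
  interpret E: product_sigma_finite "\<lambda>i::nat. density lborel (\<lambda>x. ennreal (exponential_density (1 / \<nu> i) x))"
    by (rule product_sigma_finite_exponential) (rule \<nu>)
  interpret L: product_sigma_finite "\<lambda>_::nat. lborel :: real measure"
    by (simp add: product_sigma_finite_def lborel.sigma_finite_measure_axioms)
  have "density (PiM {..<n} (\<lambda>_. lborel)) (\<lambda>x. \<Prod>i<n. ennreal (exponential_density (1 / \<nu> i) (x i))) = obs_law n \<nu>"
    unfolding obs_law_def
  proof (rule E.PiM_eqI)
    show "sets (density (PiM {..<n} (\<lambda>_. lborel)) (\<lambda>x. \<Prod>i<n. ennreal (exponential_density (1 / \<nu> i) (x i)))) =
       sets (PiM {..<n} (\<lambda>i. density lborel (\<lambda>x. ennreal (exponential_density (1 / \<nu> i) x))))"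
      by (simp, rule sets_PiM_cong) auto
    fix A :: "nat \<Rightarrow> real set"
    assume A: "\<And>i. i \<in> {..<n} \<Longrightarrow> A i \<in> sets (density lborel (\<lambda>x. ennreal (exponential_density (1 / \<nu> i) x)))"
    have [measurable]: "PiE {..<n} A \<in> sets (PiM {..<n} (\<lambda>_. lborel))"
      using A by (intro sets_PiM_I_finite) auto
    have "emeasure (density (PiM {..<n} (\<lambda>_. lborel)) (\<lambda>x. \<Prod>i<n. ennreal (exponential_density (1 / \<nu> i) (x i)))) (PiE {..<n} A)
      = (\<integral>\<^sup>+x. (\<Prod>i<n. ennreal (exponential_density (1 / \<nu> i) (x i))) * indicator (PiE {..<n} A) x \<partial>PiM {..<n} (\<lambda>_. lborel))"
      by (intro emeasure_density) auto
    also have "\<dots> = (\<integral>\<^sup>+x. (\<Prod>i<n. ennreal (exponential_density (1 / \<nu> i) (x i)) * indicator (A i) (x i)) \<partial>PiM {..<n} (\<lambda>_. lborel))"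
    proof (rule nn_integral_cong)
      fix x :: "nat \<Rightarrow> real" assume "x \<in> space (PiM {..<n} (\<lambda>_. lborel))"
      then have "indicator (PiE {..<n} A) x = (\<Prod>i<n. indicator (A i) (x i) :: ennreal)"
        by (auto simp: indicator_def space_PiM PiE_iff prod_zero_iff)
      then show "(\<Prod>i<n. ennreal (exponential_density (1 / \<nu> i) (x i))) * indicator (PiE {..<n} A) x =
          (\<Prod>i<n. ennreal (exponential_density (1 / \<nu> i) (x i)) * indicator (A i) (x i))"
        by (simp add: prod.distrib)
    qed
    also have "\<dots> = (\<Prod>i<n. \<integral>\<^sup>+x. ennreal (exponential_density (1 / \<nu> i) x) * indicator (A i) x \<partial>lborel)"
      using A by (intro L.product_nn_integral_prod) auto
    also have "\<dots> = (\<Prod>i<n. emeasure (density lborel (\<lambda>x. ennreal (exponential_density (1 / \<nu> i) x))) (A i))"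
      using A by (intro prod.cong) (auto simp: emeasure_density)
    finally show "emeasure (density (PiM {..<n} (\<lambda>_. lborel)) (\<lambda>x. \<Prod>i<n. ennreal (exponential_density (1 / \<nu> i) (x i)))) (PiE {..<n} A)
      = (\<Prod>i<n. emeasure (density lborel (\<lambda>x. ennreal (exponential_density (1 / \<nu> i) x))) (A i))" .
  qed auto
  also have "obs_law n \<nu> = obs_law n \<mu>" by (rule obs_law_cong) (simp add: \<nu>_def)
  also have "(\<lambda>x. \<Prod>i<n. ennreal (exponential_density (1 / \<nu> i) (x i))) = (\<lambda>x. \<Prod>i<n. ennreal (exponential_density (1 / \<mu> i) (x i)))"
    by (intro ext prod.cong) (auto simp: \<nu>_def)
  finally show ?thesis by simp
qed

section \<open>Concatenation of independent blocks of coordinates\<close>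

definition append_at :: "nat \<Rightarrow> (nat \<Rightarrow> real) \<Rightarrow> (nat \<Rightarrow> real) \<Rightarrow> nat \<Rightarrow> real" where
  "append_at n x y = (\<lambda>i. if i < n then x i else y (i - n))"

lemma append_at_simps [simp]: "i < n \<Longrightarrow> append_at n x y i = x i" "append_at n x y (n + i) = y i"
  by (auto simp: append_at_def)

lemma append_at_extensional:
  "y \<in> extensional {..<m} \<Longrightarrow> append_at n x y \<in> extensional {..<n + m}"
  by (auto simp: append_at_def extensional_def)

lemma lessThan_append: "{..<n + m} = {..<n} \<union> (+) n ` {..<m :: nat}"
proof -
  have "(+) n ` {..<m} = {n..<n + m}"
    using image_add_atLeastLessThan[of n 0 m] by (simp add: lessThan_atLeast0 add.commute)
  then show ?thesis by auto
qed

lemma sum_append: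
  fixes g :: "nat \<Rightarrow> 'a::comm_monoid_add"
  shows "(\<Sum>i<n + m. g i) = (\<Sum>i<n. g i) + (\<Sum>i<m. g (n + i))"
  by (subst lessThan_append) (subst sum.union_disjoint, auto simp: sum.reindex)

lemma prod_append:
  fixes g :: "nat \<Rightarrow> 'a::comm_monoid_mult"
  shows "(\<Prod>i<n + m. g i) = (\<Prod>i<n. g i) * (\<Prod>i<m. g (n + i))"
  by (subst lessThan_append) (subst prod.union_disjoint, auto simp: prod.reindex)

lemma measurable_append_at:
  "(\<lambda>(x, y). append_at n x y) \<in>
     PiM {..<n} (\<lambda>_. borel) \<Otimes>\<^sub>M PiM {..<m} (\<lambda>_. borel) \<rightarrow>\<^sub>M PiM {..<n + m} (\<lambda>_. borel)"
proof (rule measurable_PiM_single')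
  fix i assume i: "i \<in> {..<n + m}"
  show "(\<lambda>\<omega>. (case \<omega> of (x, y) \<Rightarrow> append_at n x y) i)
      \<in> borel_measurable (PiM {..<n} (\<lambda>_. borel) \<Otimes>\<^sub>M PiM {..<m} (\<lambda>_. borel))"
  proof (cases "i < n")
    case True then show ?thesis by (simp add: append_at_def case_prod_unfold)
  next
    case False 
    then have "i - n \<in> {..<m}" using i by auto
    with False show ?thesis by (simp add: append_at_def case_prod_unfold)
  qed
next
  show "(\<lambda>(x, y). append_at n x y) \<in> space (PiM {..<n} (\<lambda>_. borel) \<Otimes>\<^sub>M PiM {..<m} (\<lambda>_. borel)) \<rightarrow>
      (\<Pi>\<^sub>E i\<in>{..<n + m}. space borel)"
    by (auto simp: space_pair_measure space_PiM PiE_def append_at_def extensional_def)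
qed

text \<open>Boxes determine a product measure, and the preimage of a box under concatenation is the
  product of two boxes. This independence of the blocks is what makes both the worst-case and the
  Bayes risks add up.\<close>

lemma obs_law_append:
  assumes \<mu>: "\<And>i. i < n \<Longrightarrow> 1 \<le> \<mu> i" and \<nu>: "\<And>i. i < m \<Longrightarrow> 1 \<le> \<nu> i"
  shows "obs_law (n + m) (append_at n \<mu> \<nu>) =
    distr (obs_law n \<mu> \<Otimes>\<^sub>M obs_law m \<nu>) (PiM {..<n + m} (\<lambda>_. borel)) (\<lambda>(x, y). append_at n x y)"
proof -
  define \<kappa> where "\<kappa> i = (if i < n + m then append_at n \<mu> \<nu> i else 1)" for i
  let ?E = "\<lambda>\<kappa> i. density lborel (\<lambda>x. ennreal (exponential_density (1 / \<kappa> i) x))"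
  have \<kappa>: "0 < \<kappa> i" for i
    using \<mu>[of i] \<nu>[of "i - n"] less_diff_conv2[of n i m] by (force simp: \<kappa>_def append_at_def)
  interpret E: product_sigma_finite "?E \<kappa>"
    by (rule product_sigma_finite_exponential) (rule \<kappa>)
  interpret N: prob_space "obs_law n \<mu>" by (rule prob_space_obs_law) (rule \<mu>)
  interpret M: prob_space "obs_law m \<nu>" by (rule prob_space_obs_law) (rule \<nu>)
  have box: "emeasure (obs_law k \<xi>) (PiE {..<k} A) = (\<Prod>i<k. emeasure (?E \<xi> i) (A i))"
    if \<xi>: "\<And>i. i < k \<Longrightarrow> 1 \<le> \<xi> i" and A: "\<And>i. i < k \<Longrightarrow> A i \<in> sets borel" for k \<xi> A
  proof -
    interpret X: product_sigma_finite "?E (\<lambda>i. if i < k then \<xi> i else 1)"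
      using \<xi> by (intro product_sigma_finite_exponential) (force intro: less_le_trans[OF zero_less_one])
    have "emeasure (obs_law k (\<lambda>i. if i < k then \<xi> i else 1)) (PiE {..<k} A)
        = (\<Prod>i<k. emeasure (?E (\<lambda>i. if i < k then \<xi> i else 1) i) (A i))"
      unfolding obs_law_def using A by (intro X.emeasure_PiM) auto
    then show ?thesis by (simp cong: obs_law_cong)
  qed
  have [measurable]: "(\<lambda>(x, y). append_at n x y) \<in> obs_law n \<mu> \<Otimes>\<^sub>M obs_law m \<nu> \<rightarrow>\<^sub>M PiM {..<n + m} (\<lambda>_. borel)"
    using measurable_append_at
    by (subst measurable_cong_sets[OF sets_pair_measure_cong[OF sets_obs_law sets_obs_law] refl])
  have "distr (obs_law n \<mu> \<Otimes>\<^sub>M obs_law m \<nu>) (PiM {..<n + m} (\<lambda>_. borel)) (\<lambda>(x, y). append_at n x y)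
      = PiM {..<n + m} (?E \<kappa>)"
  proof (rule E.PiM_eqI)
    show "sets (distr (obs_law n \<mu> \<Otimes>\<^sub>M obs_law m \<nu>) (PiM {..<n + m} (\<lambda>_. borel)) (\<lambda>(x, y). append_at n x y))
        = sets (PiM {..<n + m} (?E \<kappa>))"
      by (simp, rule sets_PiM_cong) auto
    fix A assume A: "\<And>i. i \<in> {..<n + m} \<Longrightarrow> A i \<in> sets (?E \<kappa> i)"
    have [measurable]: "PiE {..<n + m} A \<in> sets (PiM {..<n + m} (\<lambda>_. borel))"
      using A by (intro sets_PiM_I_finite) auto
    have m1: "PiE {..<n} A \<in> sets (obs_law n \<mu>)" unfolding sets_obs_law
      using A by (intro sets_PiM_I_finite) auto
    have m2: "PiE {..<m} (\<lambda>i. A (n + i)) \<in> sets (obs_law m \<nu>)" unfolding sets_obs_law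
      using A by (intro sets_PiM_I_finite) auto
    have "(\<lambda>(x, y). append_at n x y) -` PiE {..<n + m} A \<inter> space (obs_law n \<mu> \<Otimes>\<^sub>M obs_law m \<nu>)
        = PiE {..<n} A \<times> PiE {..<m} (\<lambda>i. A (n + i))"
    proof -
      have "append_at n x y \<in> PiE {..<n + m} A \<longleftrightarrow> x \<in> PiE {..<n} A \<and> y \<in> PiE {..<m} (\<lambda>i. A (n + i))"
        if "x \<in> extensional {..<n}" "y \<in> extensional {..<m}" for x y
      proof -
        have "(\<forall>i\<in>{..<n + m}. append_at n x y i \<in> A i) \<longleftrightarrow> (\<forall>i\<in>{..<n}. x i \<in> A i) \<and> (\<forall>i\<in>{..<m}. y i \<in> A (n + i))"
          by (simp add: lessThan_append ball_Un)
        then show ?thesis using that append_at_extensional[OF that(2), of n x] by (simp add: PiE_iff)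
      qed
      then show ?thesis by (auto simp: space_pair_measure space_obs_law PiE_iff)
    qed
    then have "emeasure (distr (obs_law n \<mu> \<Otimes>\<^sub>M obs_law m \<nu>) (PiM {..<n + m} (\<lambda>_. borel)) (\<lambda>(x, y). append_at n x y)) (PiE {..<n + m} A)
       = emeasure (obs_law n \<mu>) (PiE {..<n} A) * emeasure (obs_law m \<nu>) (PiE {..<m} (\<lambda>i. A (n + i)))"
      using m1 m2 by (simp add: emeasure_distr M.emeasure_pair_measure_Times)
    also have "\<dots> = (\<Prod>i<n. emeasure (?E \<mu> i) (A i)) * (\<Prod>i<m. emeasure (?E \<nu> i) (A (n + i)))"
      using A by (subst (1 2) box) (auto simp: \<mu> \<nu>)
    also have "\<dots> = (\<Prod>i<n + m. emeasure (?E \<kappa> i) (A i))"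
      by (subst prod_append) (simp add: \<kappa>_def)
    finally show "emeasure (distr (obs_law n \<mu> \<Otimes>\<^sub>M obs_law m \<nu>) (PiM {..<n + m} (\<lambda>_. borel)) (\<lambda>(x, y). append_at n x y)) (PiE {..<n + m} A)
       = (\<Prod>i\<in>{..<n + m}. emeasure (?E \<kappa> i) (A i))" .
  qed auto
  also have "PiM {..<n + m} (?E \<kappa>) = obs_law (n + m) (append_at n \<mu> \<nu>)"
    unfolding obs_law_def by (intro PiM_cong) (auto simp: \<kappa>_def)
  finally show ?thesis ..
qed

section \<open>Total risk and Bayes lower bounds\<close>

text \<open>The constraint is on the sum and not on the average, so that budgets add under
  concatenation. Extensionality makes a parameter determined by its first n coordinates, which
  finite grids and the injectivity of concatenation rely on.\<close>

definition budget_set :: "real \<Rightarrow> nat \<Rightarrow> real \<Rightarrow> (nat \<Rightarrow> real) set" where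
  "budget_set p n c = {\<mu> \<in> extensional {..<n}. (\<forall>i<n. 1 \<le> \<mu> i) \<and> (\<Sum>i<n. ln (\<mu> i) powr p) \<le> c}"

text \<open>On the logarithmic scale positivity disappears: the class is closed under averaging and
  truncation, and the loss is an ordinary squared error.\<close>

definition log_estimators :: "nat \<Rightarrow> ((nat \<Rightarrow> real) \<Rightarrow> nat \<Rightarrow> real) set" where
  "log_estimators n = {u. \<forall>i<n. (\<lambda>x. u x i) \<in> borel_measurable (PiM {..<n} (\<lambda>_. borel))}"

definition total_risk :: "nat \<Rightarrow> ((nat \<Rightarrow> real) \<Rightarrow> nat \<Rightarrow> real) \<Rightarrow> (nat \<Rightarrow> real) \<Rightarrow> ennreal" where
  "total_risk n u \<mu> = (\<integral>\<^sup>+x. (\<Sum>i<n. ennreal ((u x i - ln (\<mu> i))\<^sup>2)) \<partial>obs_law n \<mu>)"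

lemma total_risk_cong: "(\<And>i. i < n \<Longrightarrow> \<mu> i = \<nu> i) \<Longrightarrow> total_risk n u \<mu> = total_risk n u \<nu>"
  unfolding total_risk_def by (simp cong: obs_law_cong)

lemma total_risk_eq_sum:
  assumes "u \<in> log_estimators n"
  shows "total_risk n u \<mu> = (\<Sum>i<n. \<integral>\<^sup>+x. ennreal ((u x i - ln (\<mu> i))\<^sup>2) \<partial>obs_law n \<mu>)"
  unfolding total_risk_def using assms
  by (intro nn_integral_sum) (auto simp: log_estimators_def)

lemma risk_eq_total_risk:
  assumes "(\<lambda>x i. ln (f x i)) \<in> log_estimators n"
  shows "risk n f \<mu> = ennreal (1 / real n) * total_risk n (\<lambda>x i. ln (f x i)) \<mu>"
proof -
  have "(\<lambda>x. \<Sum>i<n. ennreal ((ln (f x i) - ln (\<mu> i))\<^sup>2)) \<in> borel_measurable (obs_law n \<mu>)"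
    using assms by (intro borel_measurable_sum) (auto simp: log_estimators_def)
  then show ?thesis
    unfolding risk_def total_risk_def
    by (subst nn_integral_cmult[symmetric]) (auto simp flip: ennreal_mult' simp: sum_nonneg)
qed

lemma log_of_estimator: "f \<in> estimators n \<Longrightarrow> (\<lambda>x i. ln (f x i)) \<in> log_estimators n"
  by (auto simp: estimators_def log_estimators_def)

lemma estimator_of_log: "u \<in> log_estimators n \<Longrightarrow> (\<lambda>x i. exp (u x i)) \<in> estimators n"
  by (auto simp: estimators_def log_estimators_def)

lemma budget_set_imp_param_set:
  assumes "0 < n" "\<mu> \<in> budget_set p n (real n * \<eta> powr p)" shows "\<mu> \<in> param_set n p \<eta>"
  using assms by (auto simp: budget_set_def param_set_def field_simps)

lemma param_set_imp_budget_set: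
  assumes "0 < n" "\<mu> \<in> param_set n p \<eta>"
  shows "restrict \<mu> {..<n} \<in> budget_set p n (real n * \<eta> powr p)"
  using assms by (auto simp: budget_set_def param_set_def field_simps)

lemma max_risk_eq:
  assumes n: "0 < n" and f: "(\<lambda>x i. ln (f x i)) \<in> log_estimators n"
  shows "max_risk n p \<eta> f = ennreal (1 / real n) *
    (SUP \<mu>\<in>budget_set p n (real n * \<eta> powr p). total_risk n (\<lambda>x i. ln (f x i)) \<mu>)"
proof -
  let ?B = "budget_set p n (real n * \<eta> powr p)"
  let ?T = "total_risk n (\<lambda>x i. ln (f x i))"
  have "max_risk n p \<eta> f = (SUP \<mu>\<in>param_set n p \<eta>. ennreal (1 / real n) * ?T \<mu>)"
    unfolding max_risk_def by (simp add: risk_eq_total_risk[OF f])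
  also have "\<dots> = (SUP \<mu>\<in>?B. ennreal (1 / real n) * ?T \<mu>)"
  proof (rule antisym)
    show "(SUP \<mu>\<in>param_set n p \<eta>. ennreal (1 / real n) * ?T \<mu>) \<le> (SUP \<mu>\<in>?B. ennreal (1 / real n) * ?T \<mu>)"
    proof (rule SUP_mono)
      fix \<mu> assume "\<mu> \<in> param_set n p \<eta>"
      then show "\<exists>\<nu>\<in>?B. ennreal (1 / real n) * ?T \<mu> \<le> ennreal (1 / real n) * ?T \<nu>"
        using param_set_imp_budget_set[OF n] total_risk_cong[of n \<mu> "restrict \<mu> {..<n}"]
        by (intro bexI[of _ "restrict \<mu> {..<n}"]) auto
    qed
    show "(SUP \<mu>\<in>?B. ennreal (1 / real n) * ?T \<mu>) \<le> (SUP \<mu>\<in>param_set n p \<eta>. ennreal (1 / real n) * ?T \<mu>)"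
      using budget_set_imp_param_set[OF n] by (intro SUP_subset_mono) auto
  qed
  also have "\<dots> = ennreal (1 / real n) * (SUP \<mu>\<in>?B. ?T \<mu>)"
    by (simp add: SUP_mult_left_ennreal)
  finally show ?thesis .
qed

lemma append_budget_set:
  assumes "\<mu> \<in> budget_set p n c" "\<nu> \<in> budget_set p m d"
  shows "append_at n \<mu> \<nu> \<in> budget_set p (n + m) (c + d)"
proof -
  have "1 \<le> append_at n \<mu> \<nu> i" if "i < n + m" for i
    using assms that less_diff_conv2[of n i m] by (force simp: append_at_def budget_set_def)
  then show ?thesis
    using assms by (auto simp: budget_set_def append_at_extensional sum_append)
qed

lemma budget_setD: "\<mu> \<in> budget_set p n c \<Longrightarrow> i < n \<Longrightarrow> 1 \<le> \<mu> i"
  by (simp add: budget_set_def)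

text \<open>Finite support turns integration over the prior into a finite sum, so that measurability
  in the parameter never arises. For \<beta> \<le> 0 the inequality is trivial, since
  \<open>ennreal \<beta>\<close> is then 0.\<close>

definition bayes_lower :: "real \<Rightarrow> nat \<Rightarrow> real \<Rightarrow> real \<Rightarrow> bool" where
  "bayes_lower p n c \<beta> \<longleftrightarrow> (\<exists>F w. finite F \<and> F \<subseteq> budget_set p n c \<and> (\<forall>\<mu>\<in>F. 0 \<le> w \<mu>) \<and> sum w F = 1 \<and>
     (\<forall>u\<in>log_estimators n. ennreal \<beta> \<le> (\<Sum>\<mu>\<in>F. ennreal (w \<mu>) * total_risk n u \<mu>)))"

text \<open>An estimator of n + m coordinates may use all observations for each of them. Once the
  observations of one block are frozen, it is a legitimate estimator of the other block.\<close>

lemma section_log_estimator: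
  assumes u: "u \<in> log_estimators (n + m)"
  shows "y \<in> space (PiM {..<m} (\<lambda>_. borel)) \<Longrightarrow> (\<lambda>x. u (append_at n x y)) \<in> log_estimators n"
    and "x \<in> space (PiM {..<n} (\<lambda>_. borel)) \<Longrightarrow> (\<lambda>y i. u (append_at n x y) (n + i)) \<in> log_estimators m"
proof -
  let ?X = "PiM {..<n} (\<lambda>_. borel) :: (nat \<Rightarrow> real) measure" and ?Y = "PiM {..<m} (\<lambda>_. borel) :: (nat \<Rightarrow> real) measure"
  have app: "(\<lambda>(x, y). append_at n x y) \<in> ?X \<Otimes>\<^sub>M ?Y \<rightarrow>\<^sub>M PiM {..<n + m} (\<lambda>_. borel)"
    by (rule measurable_append_at)
  show "(\<lambda>x. u (append_at n x y)) \<in> log_estimators n" if y: "y \<in> space ?Y"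
    unfolding log_estimators_def
  proof safe
    fix i assume "i < n"
    have "(\<lambda>x. append_at n x y) \<in> ?X \<rightarrow>\<^sub>M PiM {..<n + m} (\<lambda>_. borel)"
      using measurable_comp[OF measurable_Pair2'[OF y, of ?X] app] by (simp add: comp_def)
    moreover have "(\<lambda>x. u x i) \<in> borel_measurable (PiM {..<n + m} (\<lambda>_. borel))"
      using u \<open>i < n\<close> by (simp add: log_estimators_def)
    ultimately show "(\<lambda>x. u (append_at n x y) i) \<in> borel_measurable ?X"
      by (rule measurable_compose)
  qed
  show "(\<lambda>y i. u (append_at n x y) (n + i)) \<in> log_estimators m" if x: "x \<in> space ?X"
    unfolding log_estimators_def
  proof safe
    fix i assume "i < m"
    have "(\<lambda>y. append_at n x y) \<in> ?Y \<rightarrow>\<^sub>M PiM {..<n + m} (\<lambda>_. borel)"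
      using measurable_comp[OF measurable_Pair1'[OF x, of ?Y] app] by (simp add: comp_def)
    moreover have "(\<lambda>x. u x (n + i)) \<in> borel_measurable (PiM {..<n + m} (\<lambda>_. borel))"
      using u \<open>i < m\<close> by (simp add: log_estimators_def)
    ultimately show "(\<lambda>y. u (append_at n x y) (n + i)) \<in> borel_measurable ?Y"
      by (rule measurable_compose)
  qed
qed

lemma total_risk_append:
  assumes u: "u \<in> log_estimators (n + m)"
    and \<mu>: "\<And>i. i < n \<Longrightarrow> 1 \<le> \<mu> i" and \<nu>: "\<And>i. i < m \<Longrightarrow> 1 \<le> \<nu> i"
  shows "total_risk (n + m) u (append_at n \<mu> \<nu>) =
      (\<integral>\<^sup>+y. total_risk n (\<lambda>x. u (append_at n x y)) \<mu> \<partial>obs_law m \<nu>) +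
      (\<integral>\<^sup>+x. total_risk m (\<lambda>y i. u (append_at n x y) (n + i)) \<nu> \<partial>obs_law n \<mu>)"
proof -
  interpret N: prob_space "obs_law n \<mu>" by (rule prob_space_obs_law) (rule \<mu>)
  interpret M: prob_space "obs_law m \<nu>" by (rule prob_space_obs_law) (rule \<nu>)
  interpret P: pair_sigma_finite "obs_law n \<mu>" "obs_law m \<nu>" ..
  have u'[measurable]: "(\<lambda>x. u x i) \<in> borel_measurable (PiM {..<n + m} (\<lambda>_. borel))" if "i < n + m" for i
    using u that by (simp add: log_estimators_def)
  have app: "(\<lambda>z. append_at n (fst z) (snd z)) \<in> obs_law n \<mu> \<Otimes>\<^sub>M obs_law m \<nu> \<rightarrow>\<^sub>M PiM {..<n + m} (\<lambda>_. borel)"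
    using measurable_append_at[of n m]
    by (subst measurable_cong_sets[OF sets_pair_measure_cong[OF sets_obs_law sets_obs_law] refl])
      (simp add: case_prod_unfold)
  have ua: "(\<lambda>z. u (append_at n (fst z) (snd z)) i) \<in> borel_measurable (obs_law n \<mu> \<Otimes>\<^sub>M obs_law m \<nu>)"
    if "i < n + m" for i
    by (rule measurable_compose[OF app u'[OF that]])
  let ?f = "\<lambda>z. \<Sum>i<n. ennreal ((u (append_at n (fst z) (snd z)) i - ln (\<mu> i))\<^sup>2)"
  let ?g = "\<lambda>z. \<Sum>i<m. ennreal ((u (append_at n (fst z) (snd z)) (n + i) - ln (\<nu> i))\<^sup>2)"
  have fm: "?f \<in> borel_measurable (obs_law n \<mu> \<Otimes>\<^sub>M obs_law m \<nu>)"
    using ua by (intro borel_measurable_sum) simp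
  have gm: "?g \<in> borel_measurable (obs_law n \<mu> \<Otimes>\<^sub>M obs_law m \<nu>)"
    using ua by (intro borel_measurable_sum) simp
  have "total_risk (n + m) u (append_at n \<mu> \<nu>) = (\<integral>\<^sup>+z. (\<Sum>i<n + m.
      ennreal ((u (append_at n (fst z) (snd z)) i - ln (append_at n \<mu> \<nu> i))\<^sup>2)) \<partial>(obs_law n \<mu> \<Otimes>\<^sub>M obs_law m \<nu>))"
    unfolding total_risk_def
    by (subst obs_law_append[OF \<mu> \<nu>], assumption, assumption, subst nn_integral_distr)
      (use app u' in \<open>auto simp: case_prod_unfold\<close>)
  also have "\<dots> = (\<integral>\<^sup>+z. ?f z + ?g z \<partial>(obs_law n \<mu> \<Otimes>\<^sub>M obs_law m \<nu>))"
    by (simp add: sum_append)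
  also have "\<dots> = (\<integral>\<^sup>+z. ?f z \<partial>(obs_law n \<mu> \<Otimes>\<^sub>M obs_law m \<nu>)) + (\<integral>\<^sup>+z. ?g z \<partial>(obs_law n \<mu> \<Otimes>\<^sub>M obs_law m \<nu>))"
    by (rule nn_integral_add[OF fm gm])
  also have "(\<integral>\<^sup>+z. ?f z \<partial>(obs_law n \<mu> \<Otimes>\<^sub>M obs_law m \<nu>)) = (\<integral>\<^sup>+y. total_risk n (\<lambda>x. u (append_at n x y)) \<mu> \<partial>obs_law m \<nu>)"
    unfolding total_risk_def by (subst P.nn_integral_snd[symmetric]) (use fm in \<open>auto simp: case_prod_unfold\<close>)
  also have "(\<integral>\<^sup>+z. ?g z \<partial>(obs_law n \<mu> \<Otimes>\<^sub>M obs_law m \<nu>)) = (\<integral>\<^sup>+x. total_risk m (\<lambda>y i. u (append_at n x y) (n + i)) \<nu> \<partial>obs_law n \<mu>)"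
    unfolding total_risk_def by (subst M.nn_integral_fst[symmetric]) (use gm in \<open>auto simp: case_prod_unfold\<close>)
  finally show ?thesis .
qed

lemma total_risk_section_measurable:
  assumes u: "u \<in> log_estimators (n + m)" and \<mu>: "\<And>i. i < n \<Longrightarrow> 1 \<le> \<mu> i"
  shows "(\<lambda>y. total_risk n (\<lambda>x. u (append_at n x y)) \<mu>) \<in> borel_measurable (PiM {..<m} (\<lambda>_. borel))"
proof -
  interpret N: prob_space "obs_law n \<mu>" by (rule prob_space_obs_law) (rule \<mu>)
  have app: "(\<lambda>(y, x). append_at n x y) \<in> PiM {..<m} (\<lambda>_. borel) \<Otimes>\<^sub>M obs_law n \<mu> \<rightarrow>\<^sub>M PiM {..<n + m} (\<lambda>_. borel)"
    using measurable_compose[OF measurable_pair_swap' measurable_append_at[of n m]]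
    by (subst measurable_cong_sets[OF sets_pair_measure_cong[OF refl sets_obs_law] refl])
      (simp add: case_prod_unfold)
  have "(\<lambda>z. u (append_at n (snd z) (fst z)) i) \<in> borel_measurable (PiM {..<m} (\<lambda>_. borel) \<Otimes>\<^sub>M obs_law n \<mu>)"
    if "i < n" for i
    using measurable_comp[OF app, of "\<lambda>x. u x i" borel] u that by (simp add: log_estimators_def case_prod_unfold comp_def)
  then have "(\<lambda>(y, x). \<Sum>i<n. ennreal ((u (append_at n x y) i - ln (\<mu> i))\<^sup>2))
      \<in> borel_measurable (PiM {..<m} (\<lambda>_. borel) \<Otimes>\<^sub>M obs_law n \<mu>)"
    unfolding case_prod_unfold by (intro borel_measurable_sum) simp
  from N.borel_measurable_nn_integral[OF this] show ?thesis by (simp add: total_risk_def)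
qed

lemma total_risk_section_measurable':
  assumes u: "u \<in> log_estimators (n + m)" and \<nu>: "\<And>i. i < m \<Longrightarrow> 1 \<le> \<nu> i"
  shows "(\<lambda>x. total_risk m (\<lambda>y i. u (append_at n x y) (n + i)) \<nu>) \<in> borel_measurable (PiM {..<n} (\<lambda>_. borel))"
proof -
  interpret N: prob_space "obs_law m \<nu>" by (rule prob_space_obs_law) (rule \<nu>)
  have app: "(\<lambda>(x, y). append_at n x y) \<in> PiM {..<n} (\<lambda>_. borel) \<Otimes>\<^sub>M obs_law m \<nu> \<rightarrow>\<^sub>M PiM {..<n + m} (\<lambda>_. borel)"
    using measurable_append_at[of n m]
    by (subst measurable_cong_sets[OF sets_pair_measure_cong[OF refl sets_obs_law] refl])
  have "(\<lambda>z. u (append_at n (fst z) (snd z)) (n + i)) \<in> borel_measurable (PiM {..<n} (\<lambda>_. borel) \<Otimes>\<^sub>M obs_law m \<nu>)"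
    if "i < m" for i
    using measurable_comp[OF app, of "\<lambda>x. u x (n + i)" borel] u that by (simp add: log_estimators_def case_prod_unfold comp_def)
  then have "(\<lambda>(x, y). \<Sum>i<m. ennreal ((u (append_at n x y) (n + i) - ln (\<nu> i))\<^sup>2))
      \<in> borel_measurable (PiM {..<n} (\<lambda>_. borel) \<Otimes>\<^sub>M obs_law m \<nu>)"
    unfolding case_prod_unfold by (intro borel_measurable_sum) simp
  from N.borel_measurable_nn_integral[OF this] show ?thesis by (simp add: total_risk_def)
qed

lemma bayes_lower_append:
  assumes "bayes_lower p n c \<beta>" "bayes_lower p m d \<gamma>"
  shows "bayes_lower p (n + m) (c + d) (\<beta> + \<gamma>)"
proof -
  obtain F v where F: "finite F" "F \<subseteq> budget_set p n c" "\<forall>\<mu>\<in>F. 0 \<le> v \<mu>" "sum v F = 1"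
    "\<forall>u\<in>log_estimators n. ennreal \<beta> \<le> (\<Sum>\<mu>\<in>F. ennreal (v \<mu>) * total_risk n u \<mu>)"
    using assms(1) unfolding bayes_lower_def by blast
  obtain G w where G: "finite G" "G \<subseteq> budget_set p m d" "\<forall>\<mu>\<in>G. 0 \<le> w \<mu>" "sum w G = 1"
    "\<forall>u\<in>log_estimators m. ennreal \<gamma> \<le> (\<Sum>\<nu>\<in>G. ennreal (w \<nu>) * total_risk m u \<nu>)"
    using assms(2) unfolding bayes_lower_def by blast
  have F1: "1 \<le> \<mu> i" if "\<mu> \<in> F" "i < n" for \<mu> i using F(2) that by (auto simp: budget_set_def)
  have G1: "1 \<le> \<nu> i" if "\<nu> \<in> G" "i < m" for \<nu> i using G(2) that by (auto simp: budget_set_def)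
  let ?a = "\<lambda>(\<mu>, \<nu>). append_at n \<mu> \<nu>"
  have inj: "inj_on ?a (F \<times> G)"
  proof (rule inj_onI, clarify)
    fix \<mu> \<nu> \<mu>' \<nu>' assume *: "\<mu> \<in> F" "\<nu> \<in> G" "\<mu>' \<in> F" "\<nu>' \<in> G" and eq: "append_at n \<mu> \<nu> = append_at n \<mu>' \<nu>'"
    have "\<mu> i = \<mu>' i" if "i < n" for i using fun_cong[OF eq, of i] that by simp
    then have "\<mu> = \<mu>'" using * F(2)
      by (intro extensionalityI[of _ "{..<n}"]) (auto simp: budget_set_def)
    moreover have "\<nu> = \<nu>'" using fun_cong[OF eq, of "n + i" for i] by auto
    ultimately show "\<mu> = \<mu>' \<and> \<nu> = \<nu>'" by simp
  qed
  \<comment> \<open>The product weight has to be a function of the concatenated parameter, so the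
    two halves are recovered by inverting \<open>append_at\<close> on the support.\<close>
  define wt where "wt \<kappa> = (case inv_into (F \<times> G) ?a \<kappa> of (\<mu>, \<nu>) \<Rightarrow> v \<mu> * w \<nu>)" for \<kappa>
  have wt: "wt (append_at n \<mu> \<nu>) = v \<mu> * w \<nu>" if "\<mu> \<in> F" "\<nu> \<in> G" for \<mu> \<nu>
    using inv_into_f_f[OF inj, of "(\<mu>, \<nu>)"] that by (simp add: wt_def)
  have sumF: "(\<Sum>\<mu>\<in>F. ennreal (v \<mu>)) = 1" using F by (simp add: sum_ennreal)
  have sumG: "(\<Sum>\<nu>\<in>G. ennreal (w \<nu>)) = 1" using G by (simp add: sum_ennreal)
  show ?thesis unfolding bayes_lower_def
  proof (intro exI[of _ "?a ` (F \<times> G)"] exI[of _ wt] conjI ballI)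
    show "finite (?a ` (F \<times> G))" using F G by simp
    show "?a ` (F \<times> G) \<subseteq> budget_set p (n + m) (c + d)"
      using F(2) G(2) append_budget_set by fastforce
    show "0 \<le> wt \<kappa>" if "\<kappa> \<in> ?a ` (F \<times> G)" for \<kappa> using that F(3) G(3) wt by auto
    show "sum wt (?a ` (F \<times> G)) = 1"
    proof -
      have "sum wt (?a ` (F \<times> G)) = (\<Sum>(\<mu>, \<nu>)\<in>F \<times> G. v \<mu> * w \<nu>)"
        by (subst sum.reindex[OF inj]) (auto intro!: sum.cong simp: wt)
      also have "\<dots> = sum v F * sum w G" by (simp add: sum_product sum.cartesian_product)
      finally show ?thesis using F G by simp
    qed
    fix u assume u: "u \<in> log_estimators (n + m)"
    let ?A = "\<lambda>\<mu> \<nu>. \<integral>\<^sup>+y. total_risk n (\<lambda>x. u (append_at n x y)) \<mu> \<partial>obs_law m \<nu>"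
    let ?B = "\<lambda>\<mu> \<nu>. \<integral>\<^sup>+x. total_risk m (\<lambda>y i. u (append_at n x y) (n + i)) \<nu> \<partial>obs_law n \<mu>"
    have A: "ennreal \<beta> \<le> (\<Sum>\<mu>\<in>F. ennreal (v \<mu>) * ?A \<mu> \<nu>)" if \<nu>: "\<nu> \<in> G" for \<nu>
    proof -
      interpret M: prob_space "obs_law m \<nu>" by (rule prob_space_obs_law) (rule G1[OF \<nu>])
      have meas: "(\<lambda>y. total_risk n (\<lambda>x. u (append_at n x y)) \<mu>) \<in> borel_measurable (obs_law m \<nu>)"
        if "\<mu> \<in> F" for \<mu>
        using total_risk_section_measurable[OF u F1[OF that]]
        by (subst measurable_cong_sets[OF sets_obs_law refl])
      have "ennreal \<beta> = (\<integral>\<^sup>+y. ennreal \<beta> \<partial>obs_law m \<nu>)" by (simp add: M.emeasure_space_1)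
      also have "\<dots> \<le> (\<integral>\<^sup>+y. (\<Sum>\<mu>\<in>F. ennreal (v \<mu>) * total_risk n (\<lambda>x. u (append_at n x y)) \<mu>) \<partial>obs_law m \<nu>)"
        using F(5) section_log_estimator(1)[OF u]
        by (intro nn_integral_mono) (auto simp: sets_eq_imp_space_eq[OF sets_obs_law])
      also have "\<dots> = (\<Sum>\<mu>\<in>F. ennreal (v \<mu>) * ?A \<mu> \<nu>)"
        using meas by (subst nn_integral_sum) (auto intro!: sum.cong nn_integral_cmult)
      finally show ?thesis .
    qed
    have B: "ennreal \<gamma> \<le> (\<Sum>\<nu>\<in>G. ennreal (w \<nu>) * ?B \<mu> \<nu>)" if \<mu>: "\<mu> \<in> F" for \<mu>
    proof -
      interpret M: prob_space "obs_law n \<mu>" by (rule prob_space_obs_law) (rule F1[OF \<mu>])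
      have meas: "(\<lambda>x. total_risk m (\<lambda>y i. u (append_at n x y) (n + i)) \<nu>) \<in> borel_measurable (obs_law n \<mu>)"
        if "\<nu> \<in> G" for \<nu>
        using total_risk_section_measurable'[OF u G1[OF that]]
        by (subst measurable_cong_sets[OF sets_obs_law refl])
      have "ennreal \<gamma> = (\<integral>\<^sup>+y. ennreal \<gamma> \<partial>obs_law n \<mu>)" by (simp add: M.emeasure_space_1)
      also have "\<dots> \<le> (\<integral>\<^sup>+x. (\<Sum>\<nu>\<in>G. ennreal (w \<nu>) * total_risk m (\<lambda>y i. u (append_at n x y) (n + i)) \<nu>) \<partial>obs_law n \<mu>)"
        using G(5) section_log_estimator(2)[OF u]
        by (intro nn_integral_mono) (auto simp: sets_eq_imp_space_eq[OF sets_obs_law])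
      also have "\<dots> = (\<Sum>\<nu>\<in>G. ennreal (w \<nu>) * ?B \<mu> \<nu>)"
        using meas by (subst nn_integral_sum) (auto intro!: sum.cong nn_integral_cmult)
      finally show ?thesis .
    qed
    \<comment> \<open>Only an inequality, because either bound may be negative and
      \<open>ennreal\<close> cuts off at 0.\<close>
    have "ennreal (\<beta> + \<gamma>) \<le> ennreal \<beta> + ennreal \<gamma>"
      by (cases "\<beta> \<ge> 0"; cases "\<gamma> \<ge> 0") (auto simp: ennreal_neg ennreal_plus[symmetric] simp del: ennreal_plus intro!: ennreal_leI)
    also have "\<dots> = (\<Sum>\<nu>\<in>G. ennreal (w \<nu>) * ennreal \<beta>) + (\<Sum>\<mu>\<in>F. ennreal (v \<mu>) * ennreal \<gamma>)"
      by (simp add: sum_distrib_right[symmetric] sumF sumG)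
    also have "\<dots> \<le> (\<Sum>\<nu>\<in>G. ennreal (w \<nu>) * (\<Sum>\<mu>\<in>F. ennreal (v \<mu>) * ?A \<mu> \<nu>)) + (\<Sum>\<mu>\<in>F. ennreal (v \<mu>) * (\<Sum>\<nu>\<in>G. ennreal (w \<nu>) * ?B \<mu> \<nu>))"
      by (intro add_mono sum_mono mult_left_mono A B) auto
    also have "(\<Sum>\<nu>\<in>G. ennreal (w \<nu>) * (\<Sum>\<mu>\<in>F. ennreal (v \<mu>) * ?A \<mu> \<nu>)) = (\<Sum>\<mu>\<in>F. \<Sum>\<nu>\<in>G. ennreal (v \<mu>) * ennreal (w \<nu>) * ?A \<mu> \<nu>)"
      by (subst sum.swap) (simp add: sum_distrib_left mult_ac)
    also have "\<dots> + (\<Sum>\<mu>\<in>F. ennreal (v \<mu>) * (\<Sum>\<nu>\<in>G. ennreal (w \<nu>) * ?B \<mu> \<nu>))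
       = (\<Sum>\<mu>\<in>F. \<Sum>\<nu>\<in>G. ennreal (v \<mu>) * ennreal (w \<nu>) * (?A \<mu> \<nu> + ?B \<mu> \<nu>))"
      by (simp add: sum_distrib_left sum.distrib distrib_left mult_ac)
    also have "\<dots> = (\<Sum>\<mu>\<in>F. \<Sum>\<nu>\<in>G. ennreal (v \<mu> * w \<nu>) * total_risk (n + m) u (append_at n \<mu> \<nu>))"
    proof (intro sum.cong refl)
      fix \<mu> \<nu> assume "\<mu> \<in> F" "\<nu> \<in> G"
      then have "total_risk (n + m) u (append_at n \<mu> \<nu>) = ?A \<mu> \<nu> + ?B \<mu> \<nu>" "0 \<le> v \<mu>" "0 \<le> w \<nu>"
        using F1 G1 F(3) G(3) by (auto intro: total_risk_append[OF u])
      then show "ennreal (v \<mu>) * ennreal (w \<nu>) * (?A \<mu> \<nu> + ?B \<mu> \<nu>)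
          = ennreal (v \<mu> * w \<nu>) * total_risk (n + m) u (append_at n \<mu> \<nu>)"
        by (simp add: ennreal_mult)
    qed
    also have "\<dots> = (\<Sum>\<kappa>\<in>?a ` (F \<times> G). ennreal (wt \<kappa>) * total_risk (n + m) u \<kappa>)"
      by (subst sum.reindex[OF inj]) (auto simp: sum.cartesian_product wt intro!: sum.cong)
    finally show "ennreal (\<beta> + \<gamma>) \<le> (\<Sum>\<kappa>\<in>?a ` (F \<times> G). ennreal (wt \<kappa>) * total_risk (n + m) u \<kappa>)" .
  qed
qed

section \<open>Risk of the thresholding estimator\<close>

text \<open>The inequality ln z \<le> z is used for the square root of x above 1 and for x powr (- 1
  / 4) below 1. These powers leave a right-hand side that is integrable against an exponential
  density, as values of the Gamma function at 2 and 1 / 2.\<close>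

lemma ln_square_bound:
  fixes x :: real
  assumes "0 < x"
  shows "(ln x)\<^sup>2 \<le> 16 * x powr (- (1 / 2)) + 4 * x"
proof (cases "x \<ge> 1")
  case True
  have "ln x = 2 * ln (sqrt x)" using assms by (simp add: ln_sqrt)
  also have "\<dots> \<le> 2 * sqrt x" using assms ln_bound[of "sqrt x"] by simp
  finally have "(ln x)\<^sup>2 \<le> (2 * sqrt x)\<^sup>2" using True by (intro power_mono) auto
  also have "\<dots> = 4 * x" using assms by (simp add: power_mult_distrib)
  finally show ?thesis using assms by (simp add: add_increasing)
next
  case False
  have "- ln x = 4 * ln (x powr (- (1 / 4)))" using assms by (simp add: ln_powr)
  also have "\<dots> \<le> 4 * x powr (- (1 / 4))" using assms ln_bound[of "x powr (- (1 / 4))"] by simp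
  finally have "(- ln x)\<^sup>2 \<le> (4 * x powr (- (1 / 4)))\<^sup>2" using False assms by (intro power_mono) auto
  also have "\<dots> = 16 * x powr (- (1 / 2))"
    by (simp add: power_mult_distrib power2_eq_square flip: powr_add)
  finally show ?thesis using assms by (simp add: add_increasing2)
qed

text \<open>A second moment of the logarithmic noise with half the exponential decay of the density;
  the other half is kept in reserve to produce the factor exp (- t / (2 \<mu>)) when integrating
  beyond the threshold.\<close>

definition log_moment :: real where
  "log_moment = enn2real (\<integral>\<^sup>+x. ennreal (indicator {0..} x * (ln x)\<^sup>2 * exp (- x / 2)) \<partial>lborel)"

lemma log_moment_nonneg: "0 \<le> log_moment"
  by (simp add: log_moment_def)

lemma nn_integral_log_moment:
  "(\<integral>\<^sup>+x. ennreal (indicator {0..} x * (ln x)\<^sup>2 * exp (- x / 2)) \<partial>lborel) = ennreal log_moment"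
proof -
  let ?g = "\<lambda>s t. ennreal (indicator {0..} t * t powr (s - 1) / exp t)"
  have gen: "ennreal (16 * a + 8 * b) = ennreal 16 * ennreal a + ennreal 8 * ennreal b"
    if "0 \<le> a" "0 \<le> b" for a b
    using that by (simp add: ennreal_mult' ennreal_plus)
  \<comment> \<open>Substituting 2 x for x restores the weight exp (- x) of the Gamma
    integrals.\<close>
  have "(\<integral>\<^sup>+x. ennreal (indicator {0..} x * (ln x)\<^sup>2 * exp (- x / 2)) \<partial>lborel)
      = ennreal \<bar>2\<bar> * (\<integral>\<^sup>+x. ennreal (indicator {0..} (0 + 2 * x) * (ln (0 + 2 * x))\<^sup>2 * exp (- (0 + 2 * x) / 2)) \<partial>lborel)"
    by (rule nn_integral_real_affine) auto
  also have "\<dots> \<le> ennreal \<bar>2\<bar> * (\<integral>\<^sup>+x. ennreal 16 * ?g (1 / 2) x + ennreal 8 * ?g 2 x \<partial>lborel)"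
  proof (intro mult_left_mono nn_integral_mono)
    fix x :: real
    show "ennreal (indicator {0..} (0 + 2 * x) * (ln (0 + 2 * x))\<^sup>2 * exp (- (0 + 2 * x) / 2))
        \<le> ennreal 16 * ?g (1 / 2) x + ennreal 8 * ?g 2 x"
    proof (cases "x > 0")
      case True
      have "(2 * x) powr (- (1 / 2)) \<le> x powr (- (1 / 2))" using True by (intro powr_mono2') auto
      then have "(ln (2 * x))\<^sup>2 \<le> 16 * x powr (- (1 / 2)) + 8 * x"
        using ln_square_bound[of "2 * x"] True by linarith
      then have "(ln (2 * x))\<^sup>2 * exp (- x) \<le> (16 * x powr (- (1 / 2)) + 8 * x) * exp (- x)"
        by (intro mult_right_mono) auto
      also have "\<dots> = 16 * (x powr (1 / 2 - 1) / exp x) + 8 * (x powr (2 - 1) / exp x)"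
        using True by (simp add: exp_minus field_simps)
      finally have "ennreal ((ln (2 * x))\<^sup>2 * exp (- x))
          \<le> ennreal (16 * (x powr (1 / 2 - 1) / exp x) + 8 * (x powr (2 - 1) / exp x))"
        by (rule ennreal_leI)
      also have "\<dots> = ennreal 16 * ennreal (x powr (1 / 2 - 1) / exp x) + ennreal 8 * ennreal (x powr (2 - 1) / exp x)"
        by (rule gen) auto
      finally show ?thesis using True by simp
    next
      case False
      then show ?thesis by (cases "x = 0") auto
    qed
  qed simp
  also have "\<dots> = ennreal 2 * (ennreal 16 * Gamma (1 / 2) + ennreal 8 * Gamma (2::real))"
    by (simp add: nn_integral_add nn_integral_cmult Gamma_conv_nn_integral_real)
  also have "\<dots> < \<top>" by (simp add: ennreal_mult_less_top ennreal_add_less_top)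
  finally show ?thesis unfolding log_moment_def by (simp add: less_top)
qed

definition thresh_risk :: "real \<Rightarrow> real \<Rightarrow> ennreal" where
  "thresh_risk t \<mu> = (\<integral>\<^sup>+x. ennreal ((ln (if t \<le> x then x else 1) - ln \<mu>)\<^sup>2)
     \<partial>density lborel (\<lambda>x. ennreal (exponential_density (1 / \<mu>) x)))"

text \<open>The exponential laws form a scale family. After division by \<mu>, a kept observation
  has error ln x with x standard exponential, whatever \<mu> is, and a discarded one has error ln
  \<mu>.\<close>

lemma thresh_risk_eq:
  assumes t: "0 < t" and \<mu>: "1 \<le> \<mu>"
  shows "thresh_risk t \<mu> = (\<integral>\<^sup>+x. ennreal (exponential_density 1 x *
    (if t \<le> \<mu> * x then (ln x)\<^sup>2 else (ln \<mu>)\<^sup>2)) \<partial>lborel)"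
proof -
  have "thresh_risk t \<mu> = (\<integral>\<^sup>+x. ennreal (exponential_density (1 / \<mu>) x) * ennreal ((ln (if t \<le> x then x else 1) - ln \<mu>)\<^sup>2) \<partial>lborel)"
    unfolding thresh_risk_def by (rule nn_integral_density) auto
  also have "\<dots> = ennreal \<bar>\<mu>\<bar> * (\<integral>\<^sup>+x. ennreal (exponential_density (1 / \<mu>) (0 + \<mu> * x)) *
      ennreal ((ln (if t \<le> 0 + \<mu> * x then 0 + \<mu> * x else 1) - ln \<mu>)\<^sup>2) \<partial>lborel)"
    using \<mu> by (intro nn_integral_real_affine) auto
  also have "\<dots> = (\<integral>\<^sup>+x. ennreal \<bar>\<mu>\<bar> * (ennreal (exponential_density (1 / \<mu>) (0 + \<mu> * x)) *
      ennreal ((ln (if t \<le> 0 + \<mu> * x then 0 + \<mu> * x else 1) - ln \<mu>)\<^sup>2)) \<partial>lborel)"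
    by (rule nn_integral_cmult[symmetric]) auto
  also have "\<dots> = (\<integral>\<^sup>+x. ennreal (exponential_density 1 x *
    (if t \<le> \<mu> * x then (ln x)\<^sup>2 else (ln \<mu>)\<^sup>2)) \<partial>lborel)"
  proof (rule nn_integral_cong)
    fix x :: real
    have "exponential_density (1 / \<mu>) (\<mu> * x) = exponential_density 1 x / \<mu>"
      using \<mu> by (auto simp: exponential_density_def zero_le_mult_iff mult_less_0_iff)
    moreover have "ln (\<mu> * x) - ln \<mu> = ln x" if "t \<le> \<mu> * x"
    proof -
      have "0 < x" using that t \<mu> by (metis less_le_trans zero_less_mult_pos zero_less_one)
      then show ?thesis using \<mu> by (simp add: ln_mult)
    qed
    ultimately show "ennreal \<bar>\<mu>\<bar> * (ennreal (exponential_density (1 / \<mu>) (0 + \<mu> * x)) *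
        ennreal ((ln (if t \<le> 0 + \<mu> * x then 0 + \<mu> * x else 1) - ln \<mu>)\<^sup>2)) =
      ennreal (exponential_density 1 x * (if t \<le> \<mu> * x then (ln x)\<^sup>2 else (ln \<mu>)\<^sup>2))"
      using \<mu> by (simp add: exponential_density_nonneg flip: ennreal_mult)
  qed
  finally show ?thesis .
qed

text \<open>The first term is the noise of a kept observation, where x \<ge> t / \<mu> and half of
  the decay of exp (- x) is traded for exp (- t / (2 \<mu>)). The second is the loss of a missed
  signal times the probability of missing it, the density being at most 1.\<close>

lemma thresh_risk_bound:
  assumes t: "0 < t" and \<mu>: "1 \<le> \<mu>"
  shows "thresh_risk t \<mu> \<le> ennreal (exp (- t / (2 * \<mu>)) * log_moment + (ln \<mu>)\<^sup>2 * min 1 (t / \<mu>))"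
proof -
  let ?J = "\<lambda>x. ennreal (indicator {0..} x * (ln x)\<^sup>2 * exp (- x / 2))"
  let ?D = "density lborel (\<lambda>x. ennreal (exponential_density 1 x))"
  interpret D: prob_space ?D by (rule prob_space_exponential_density) simp
  have "emeasure ?D {..<t / \<mu>} \<le> ennreal (t / \<mu>)"
  proof -
    have "emeasure ?D {..<t / \<mu>} = (\<integral>\<^sup>+x. ennreal (exponential_density 1 x) * indicator {..<t / \<mu>} x \<partial>lborel)"
      by (simp add: emeasure_density)
    also have "\<dots> \<le> (\<integral>\<^sup>+x. indicator {0..t / \<mu>} x \<partial>lborel)"
      by (intro nn_integral_mono) (auto simp: indicator_def exponential_density_def)
    also have "\<dots> = ennreal (t / \<mu>)" using t \<mu> by simp
    finally show ?thesis .
  qed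
  then have D: "emeasure ?D {..<t / \<mu>} \<le> ennreal (min 1 (t / \<mu>))"
    using D.emeasure_le_1[of "{..<t / \<mu>}"] by (auto simp: min_def)
  have "thresh_risk t \<mu> \<le> (\<integral>\<^sup>+x. ennreal (exp (- t / (2 * \<mu>))) * ?J x +
      ennreal ((ln \<mu>)\<^sup>2) * (ennreal (exponential_density 1 x) * indicator {..<t / \<mu>} x) \<partial>lborel)"
    unfolding thresh_risk_eq[OF assms]
  proof (rule nn_integral_mono)
    fix x :: real
    show "ennreal (exponential_density 1 x * (if t \<le> \<mu> * x then (ln x)\<^sup>2 else (ln \<mu>)\<^sup>2)) \<le>
      ennreal (exp (- t / (2 * \<mu>))) * ?J x + ennreal ((ln \<mu>)\<^sup>2) * (ennreal (exponential_density 1 x) * indicator {..<t / \<mu>} x)"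
    proof (cases "t \<le> \<mu> * x")
      case True
      then have x: "0 \<le> x" "t / \<mu> \<le> x" using t \<mu>
        by (auto simp: field_simps) (metis less_le_trans zero_less_mult_pos zero_less_one less_imp_le)
      have "exp (- x) = exp (- x / 2) * exp (- x / 2)" by (simp flip: exp_add)
      also have "\<dots> \<le> exp (- t / (2 * \<mu>)) * exp (- x / 2)"
        using x \<mu> by (intro mult_right_mono) (auto simp: field_simps)
      finally have "exp (- x) * (ln x)\<^sup>2 \<le> exp (- t / (2 * \<mu>)) * ((ln x)\<^sup>2 * exp (- x / 2))"
        by (metis mult.assoc mult.commute mult_right_mono zero_le_power2)
      then have "ennreal (exponential_density 1 x * (ln x)\<^sup>2) \<le> ennreal (exp (- t / (2 * \<mu>))) * ?J x"
        using x by (simp add: exponential_density_def flip: ennreal_mult)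
      then show ?thesis using True by (simp add: add_increasing2)
    next
      case False
      then have "x < t / \<mu>" using \<mu> by (simp add: field_simps)
      then show ?thesis using False
        by (simp add: exponential_density_nonneg ennreal_mult mult.commute add_increasing)
    qed
  qed
  also have "\<dots> = ennreal (exp (- t / (2 * \<mu>))) * ennreal log_moment + ennreal ((ln \<mu>)\<^sup>2) * emeasure ?D {..<t / \<mu>}"
    by (simp add: nn_integral_add nn_integral_cmult nn_integral_log_moment[simplified] emeasure_density)
  also have "\<dots> \<le> ennreal (exp (- t / (2 * \<mu>))) * ennreal log_moment + ennreal ((ln \<mu>)\<^sup>2) * ennreal (min 1 (t / \<mu>))"
    using D by (intro add_mono mult_left_mono) auto
  also have "\<dots> = ennreal (exp (- t / (2 * \<mu>)) * log_moment + (ln \<mu>)\<^sup>2 * min 1 (t / \<mu>))"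
    using t \<mu> log_moment_nonneg by (simp add: ennreal_mult ennreal_plus)
  finally show ?thesis .
qed

text \<open>The growth of \<open>(ln \<mu>)\<^sup>2\<close>, at most 2 \<mu>, is cancelled by the
  probability t / \<mu> of a miss. A bound free of \<mu> makes all worst-case risks finite and of at
  most linear growth in n.\<close>

lemma thresh_risk_uniform:
  assumes t: "0 < t" and \<mu>: "1 \<le> \<mu>"
  shows "thresh_risk t \<mu> \<le> ennreal (log_moment + 2 * t)"
proof -
  have "(ln \<mu>)\<^sup>2 \<le> 2 * \<mu>"
    using exp_lower_Taylor_quadratic[of "ln \<mu>", OF ln_ge_zero[OF \<mu>]] ln_ge_zero[OF \<mu>] \<mu> exp_ln[of \<mu>]
    by linarith
  then have "(ln \<mu>)\<^sup>2 * (t / \<mu>) \<le> 2 * \<mu> * (t / \<mu>)" using t \<mu> by (intro mult_right_mono) auto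
  then have "(ln \<mu>)\<^sup>2 * min 1 (t / \<mu>) \<le> 2 * t"
    using \<mu> mult_left_mono[of "min 1 (t / \<mu>)" "t / \<mu>" "(ln \<mu>)\<^sup>2"] by auto
  moreover have "exp (- t / (2 * \<mu>)) * log_moment \<le> 1 * log_moment"
    using t \<mu> log_moment_nonneg by (intro mult_right_mono) auto
  ultimately show ?thesis
    by (intro order_trans[OF thresh_risk_bound[OF assms]] ennreal_leI) auto
qed

text \<open>The function \<theta> powr a * exp (- \<theta>) decreases beyond \<theta> = a, so beyond
  L \<ge> a it is largest at L; up to L the minimum is 1 and monotonicity of the power
  suffices.\<close>

lemma powr_exp_decay:
  fixes \<theta> L a :: real
  assumes "0 < a" "a \<le> L" "0 < \<theta>"
  shows "\<theta> powr a * min 1 (exp (L - \<theta>)) \<le> L powr a"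
proof (cases "\<theta> \<le> L")
  case True
  have "\<theta> powr a * min 1 (exp (L - \<theta>)) \<le> \<theta> powr a * 1" by (intro mult_left_mono) auto
  also have "\<dots> \<le> L powr a" using True assms by (simp add: powr_mono2)
  finally show ?thesis .
next
  case False
  then have L: "0 < L" "L < \<theta>" using assms by auto
  have "a * ln (\<theta> / L) \<le> L * (\<theta> / L - 1)"
    using L assms ln_le_minus_one[of "\<theta> / L"] by (intro mult_mono) auto
  also have "\<dots> = \<theta> - L" using L by (simp add: field_simps)
  finally have "(\<theta> / L) powr a \<le> exp (\<theta> - L)" using L by (simp add: powr_def mult.commute)
  then have "\<theta> powr a \<le> L powr a * exp (\<theta> - L)" using L by (simp add: powr_divide field_simps)
  then have "\<theta> powr a * exp (L - \<theta>) \<le> L powr a * exp (\<theta> - L) * exp (L - \<theta>)" by (intro mult_right_mono) auto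
  also have "\<dots> = L powr a" by (simp add: mult.assoc flip: exp_add)
  finally show ?thesis by (smt (verit) mult_left_mono powr_ge_zero)
qed

text \<open>The bound is affine in \<open>ln \<mu> powr p\<close>, so that it can be summed against
  the budget. For \<theta> = ln \<mu> \<le> 1 one has \<mu> \<le> e, whence the exponent t / (2 e),
  and \<theta>^2 \<le> \<theta> powr p. For \<theta> > 1 the noise is charged to \<theta> powr p
  \<ge> 1, and the missed signal \<theta> powr p * \<theta> powr (2 - p) is controlled by
  \<open>powr_exp_decay\<close> with L = ln t.\<close>

lemma thresh_risk_sparse:
  assumes p: "0 < p" "p < 2" and t: "0 < t" "2 - p \<le> ln t" and \<mu>: "1 \<le> \<mu>"
  shows "thresh_risk t \<mu> \<le> ennreal (exp (- t / (2 * exp 1)) * log_moment +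
    ln \<mu> powr p * (1 + log_moment + ln t powr (2 - p)))"
proof (rule order_trans[OF thresh_risk_bound[OF t(1) \<mu>]], rule ennreal_leI)
  let ?\<theta> = "ln \<mu>"
  have \<theta>0: "0 \<le> ?\<theta>" using \<mu> by simp
  show "exp (- t / (2 * \<mu>)) * log_moment + ?\<theta>\<^sup>2 * min 1 (t / \<mu>) \<le>
      exp (- t / (2 * exp 1)) * log_moment + ?\<theta> powr p * (1 + log_moment + ln t powr (2 - p))"
  proof (cases "?\<theta> \<le> 1")
    case True
    then have "\<mu> \<le> exp 1" using \<mu> by (metis exp_ln exp_le_cancel_iff less_le_trans zero_less_one)
    then have "exp (- t / (2 * \<mu>)) \<le> exp (- t / (2 * exp 1))"
      using t \<mu> by (simp add: field_simps)
    then have "exp (- t / (2 * \<mu>)) * log_moment \<le> exp (- t / (2 * exp 1)) * log_moment"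
      using log_moment_nonneg by (intro mult_right_mono)
    moreover have "?\<theta>\<^sup>2 * min 1 (t / \<mu>) \<le> ?\<theta> powr p * (1 + log_moment + ln t powr (2 - p))"
    proof (cases "?\<theta> = 0")
      case False
      have "?\<theta>\<^sup>2 = ?\<theta> powr 2" using False \<theta>0 by simp
      also have "\<dots> \<le> ?\<theta> powr p" using p True \<theta>0 False by (intro powr_mono') auto
      finally have "?\<theta>\<^sup>2 * min 1 (t / \<mu>) \<le> ?\<theta> powr p * 1"
        using t \<mu> by (intro mult_mono) auto
      also have "\<dots> \<le> ?\<theta> powr p * (1 + log_moment + ln t powr (2 - p))"
        using log_moment_nonneg by (intro mult_left_mono) auto
      finally show ?thesis .
    qed (use log_moment_nonneg in auto)
    ultimately show ?thesis by simp
  next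
    case False
    then have \<theta>: "1 < ?\<theta>" by simp
    then have 1: "1 \<le> ?\<theta> powr p" using p by (simp add: ge_one_powr_ge_zero)
    have "exp (- t / (2 * \<mu>)) * log_moment \<le> 1 * log_moment"
      using t \<mu> log_moment_nonneg by (intro mult_right_mono) auto
    also have "\<dots> \<le> ?\<theta> powr p * log_moment" using 1 log_moment_nonneg by (intro mult_right_mono) auto
    finally have a: "exp (- t / (2 * \<mu>)) * log_moment \<le> ?\<theta> powr p * log_moment" .
    have "t / \<mu> = exp (ln t - ?\<theta>)" using t \<mu> by (simp add: exp_diff)
    then have "?\<theta> powr (2 - p) * min 1 (t / \<mu>) \<le> ln t powr (2 - p)"
      using powr_exp_decay[of "2 - p" "ln t" ?\<theta>] p t \<theta> by simp
    then have "?\<theta> powr p * (?\<theta> powr (2 - p) * min 1 (t / \<mu>)) \<le> ?\<theta> powr p * (ln t powr (2 - p))"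
      by (intro mult_left_mono) auto
    moreover have "?\<theta> powr p * ?\<theta> powr (2 - p) = ?\<theta>\<^sup>2"
      using \<theta> by (simp flip: powr_add)
    ultimately have "?\<theta>\<^sup>2 * min 1 (t / \<mu>) \<le> ?\<theta> powr p * ln t powr (2 - p)"
      by (metis mult.assoc)
    moreover have "0 \<le> exp (- t / (2 * exp 1)) * log_moment" using log_moment_nonneg by simp
    ultimately show ?thesis using a 1 by (simp add: algebra_simps)
  qed
qed

lemma thresh_log_estimator: "(\<lambda>x i. ln (thresh_est t x i)) \<in> log_estimators n"
  by (auto simp: log_estimators_def thresh_est_def)

lemma thresh_estimator: "0 < t \<Longrightarrow> thresh_est t \<in> estimators n"
  by (auto simp: estimators_def thresh_est_def)

lemma total_risk_thresh:
  assumes "\<And>i. i < n \<Longrightarrow> 1 \<le> \<mu> i"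
  shows "total_risk n (\<lambda>x i. ln (thresh_est t x i)) \<mu> = (\<Sum>i<n. thresh_risk t (\<mu> i))"
  unfolding total_risk_eq_sum[OF thresh_log_estimator]
proof (rule sum.cong)
  fix i assume i: "i \<in> {..<n}"
  then show "(\<integral>\<^sup>+x. ennreal ((ln (thresh_est t x i) - ln (\<mu> i))\<^sup>2) \<partial>obs_law n \<mu>) = thresh_risk t (\<mu> i)"
    using obs_law_component[where g = "\<lambda>x. ennreal ((ln (if t \<le> x then x else 1) - ln (\<mu> i))\<^sup>2)", OF assms]
    by (simp add: thresh_est_def thresh_risk_def)
qed simp

lemma one_in_budget_set: "0 \<le> c \<Longrightarrow> restrict (\<lambda>_. 1) {..<n} \<in> budget_set p n c"
  by (simp add: budget_set_def)

lemma max_risk_thresh_limit: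
  assumes p: "0 < p" "p < 2" and t: "0 < t"
  obtains A where "(\<lambda>n. enn2real (max_risk n p \<eta> (thresh_est t))) \<longlonglongrightarrow> A"
    and "\<And>n. 0 < n \<Longrightarrow> max_risk n p \<eta> (thresh_est t) \<le> ennreal (log_moment + 2 * t)"
    and "2 - p \<le> ln t \<Longrightarrow> A \<le> exp (- t / (2 * exp 1)) * log_moment +
      \<eta> powr p * (1 + log_moment + ln t powr (2 - p))"
proof -
  define \<rho> where "\<rho> \<mu> = enn2real (thresh_risk t \<mu>)" for \<mu>
  have \<rho>: "thresh_risk t \<mu> = ennreal (\<rho> \<mu>)" "0 \<le> \<rho> \<mu>" "\<rho> \<mu> \<le> log_moment + 2 * t" if "1 \<le> \<mu>" for \<mu>
  proof -
    have "thresh_risk t \<mu> < \<top>" using thresh_risk_uniform[OF t that] by (rule order_le_less_trans) simp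
    then show "thresh_risk t \<mu> = ennreal (\<rho> \<mu>)" by (simp add: \<rho>_def)
    then show "\<rho> \<mu> \<le> log_moment + 2 * t"
      using thresh_risk_uniform[OF t that] log_moment_nonneg t by (simp del: ennreal_plus)
  qed (simp add: \<rho>_def)
  define s where "s = \<eta> powr p"
  let ?B = "\<lambda>n. budget_set p n (real n * s)"
  define a where "a n = (SUP \<mu>\<in>?B n. \<Sum>i<n. \<rho> (\<mu> i))" for n
  have s: "0 \<le> s" by (simp add: s_def)
  have ne: "?B n \<noteq> {}" for n using one_in_budget_set[of "real n * s" n p] s by auto
  have ub: "(\<Sum>i<n. \<rho> (\<mu> i)) \<le> (log_moment + 2 * t) * real n" if "\<mu> \<in> ?B n" for \<mu> n
    using sum_bounded_above[of "{..<n}" "\<lambda>i. \<rho> (\<mu> i)" "log_moment + 2 * t"] \<rho>(3) budget_setD[OF that]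
    by (simp add: mult.commute)
  have bdd: "bdd_above ((\<lambda>\<mu>. \<Sum>i<n. \<rho> (\<mu> i)) ` ?B n)" for n
    using ub by (intro bdd_aboveI2) auto
  have a_le: "a n \<le> (log_moment + 2 * t) * real n" for n
    unfolding a_def using ub by (intro cSUP_least ne) auto
  have pos: "0 \<le> (\<Sum>i<n. \<rho> (\<mu> i))" if "\<mu> \<in> ?B n" for \<mu> n
    using \<rho>(2) budget_setD[OF that] by (intro sum_nonneg) auto
  have a_nonneg: "0 \<le> a n" for n
  proof -
    obtain \<mu> where \<mu>: "\<mu> \<in> ?B n" using ne[of n] by blast
    show ?thesis unfolding a_def by (rule order_trans[OF pos[OF \<mu>] cSUP_upper[OF \<mu> bdd]])
  qed
  have super: "a m + a n \<le> a (m + n)" for m n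
  proof -
    have "(\<Sum>i<m. \<rho> (\<mu> i)) \<le> a (m + n) - a n" if \<mu>: "\<mu> \<in> ?B m" for \<mu>
    proof -
      have "(\<Sum>i<n. \<rho> (\<nu> i)) \<le> a (m + n) - (\<Sum>i<m. \<rho> (\<mu> i))" if \<nu>: "\<nu> \<in> ?B n" for \<nu>
      proof -
        have "append_at m \<mu> \<nu> \<in> ?B (m + n)"
          using append_budget_set[OF \<mu> \<nu>] by (simp add: distrib_right)
        then have "(\<Sum>i<m + n. \<rho> (append_at m \<mu> \<nu> i)) \<le> a (m + n)"
          unfolding a_def by (rule cSUP_upper[OF _ bdd])
        then show ?thesis by (simp add: sum_append)
      qed
      then have "a n \<le> a (m + n) - (\<Sum>i<m. \<rho> (\<mu> i))" unfolding a_def[of n] by (intro cSUP_least ne)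
      then show ?thesis by simp
    qed
    then have "a m \<le> a (m + n) - a n" unfolding a_def[of m] by (intro cSUP_least ne)
    then show ?thesis by simp
  qed
  have eq: "max_risk n p \<eta> (thresh_est t) = ennreal (a n / real n)" if n: "0 < n" for n
  proof -
    have T: "total_risk n (\<lambda>x i. ln (thresh_est t x i)) \<mu> = ennreal (\<Sum>i<n. \<rho> (\<mu> i))" if "\<mu> \<in> ?B n" for \<mu>
    proof -
      have "total_risk n (\<lambda>x i. ln (thresh_est t x i)) \<mu> = (\<Sum>i<n. thresh_risk t (\<mu> i))"
        by (rule total_risk_thresh) (rule budget_setD[OF that])
      also have "\<dots> = (\<Sum>i<n. ennreal (\<rho> (\<mu> i)))"
        using budget_setD[OF that] \<rho>(1) by (intro sum.cong) auto
      also have "\<dots> = ennreal (\<Sum>i<n. \<rho> (\<mu> i))"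
        using budget_setD[OF that] \<rho>(2) by (intro sum_ennreal) auto
      finally show ?thesis .
    qed
    have "(SUP \<mu>\<in>?B n. ennreal (\<Sum>i<n. \<rho> (\<mu> i))) \<le> ennreal ((log_moment + 2 * t) * real n)"
      using ub by (intro SUP_least ennreal_leI) auto
    then have "(SUP \<mu>\<in>?B n. ennreal (\<Sum>i<n. \<rho> (\<mu> i))) < \<top>"
      by (rule order_le_less_trans) (rule ennreal_less_top)
    then have "(SUP \<mu>\<in>?B n. ennreal (\<Sum>i<n. \<rho> (\<mu> i))) \<noteq> \<top>" by (simp only: less_top)
    then have "(SUP \<mu>\<in>?B n. total_risk n (\<lambda>x i. ln (thresh_est t x i)) \<mu>) = ennreal (a n)"
      using ennreal_SUP[of "\<lambda>\<mu>. \<Sum>i<n. \<rho> (\<mu> i)" "?B n"] ne T by (simp add: a_def)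
    then show ?thesis using n a_nonneg
      by (simp add: max_risk_eq[OF n thresh_log_estimator] s_def[symmetric] flip: ennreal_mult)
  qed
  define A where "A = (SUP n\<in>{1..}. a n / real n)"
  have lim: "(\<lambda>n. a n / real n) \<longlonglongrightarrow> A" unfolding A_def
    by (rule superadditive_limit[OF super a_nonneg a_le])
  show thesis
  proof (rule that)
    show "(\<lambda>n. enn2real (max_risk n p \<eta> (thresh_est t))) \<longlonglongrightarrow> A"
      using lim
    proof (rule Lim_transform_eventually)
      show "\<forall>\<^sub>F n in sequentially. a n / real n = enn2real (max_risk n p \<eta> (thresh_est t))"
        using eventually_gt_at_top[of 0] by eventually_elim (simp add: eq a_nonneg)
    qed
    show "max_risk n p \<eta> (thresh_est t) \<le> ennreal (log_moment + 2 * t)" if "0 < n" for n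
      using a_le[of n] that by (auto simp: eq field_simps intro!: ennreal_leI)
    assume lt: "2 - p \<le> ln t"
    let ?e = "exp (- t / (2 * exp 1)) * log_moment" and ?k = "1 + log_moment + ln t powr (2 - p)"
    have nn: "0 \<le> ?e" "0 \<le> ?k" using log_moment_nonneg by (auto simp: add_nonneg_nonneg)
    have "a n / real n \<le> ?e + s * ?k" if n: "n \<in> {1..}" for n
    proof -
      \<comment> \<open>The affine bound turns the nonlinear worst case into the budget itself: only
        the sum of the \<open>ln (\<mu> i) powr p\<close> enters, regardless of how it is spread
        over the coordinates.\<close>
      have "a n \<le> real n * ?e + real n * s * ?k" unfolding a_def
      proof (intro cSUP_least ne)
        fix \<mu> assume \<mu>: "\<mu> \<in> ?B n"
        have "\<rho> (\<mu> i) \<le> ?e + ln (\<mu> i) powr p * ?k" if "i < n" for i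
        proof -
          have "ennreal (\<rho> (\<mu> i)) \<le> ennreal (?e + ln (\<mu> i) powr p * ?k)"
            using thresh_risk_sparse[OF p t lt budget_setD[OF \<mu> that]] \<rho>(1)[OF budget_setD[OF \<mu> that]]
            by (simp only:)
          moreover have "0 \<le> ?e + ln (\<mu> i) powr p * ?k"
            using nn by (intro add_nonneg_nonneg[OF _ mult_nonneg_nonneg]) auto
          ultimately show ?thesis by (simp only: ennreal_le_iff)
        qed
        then have "(\<Sum>i<n. \<rho> (\<mu> i)) \<le> (\<Sum>i<n. ?e + ln (\<mu> i) powr p * ?k)" by (intro sum_mono) auto
        also have "\<dots> = real n * ?e + (\<Sum>i<n. ln (\<mu> i) powr p) * ?k"
          by (simp add: sum.distrib sum_distrib_right)
        also have "\<dots> \<le> real n * ?e + real n * s * ?k"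
          using \<mu> nn by (intro add_mono mult_right_mono) (auto simp: budget_set_def)
        finally show "(\<Sum>i<n. \<rho> (\<mu> i)) \<le> real n * ?e + real n * s * ?k" .
      qed
      then show ?thesis using n by (simp add: field_simps)
    qed
    then show "A \<le> ?e + \<eta> powr p * ?k" unfolding A_def s_def[symmetric]
      by (intro cSUP_least) auto
  qed
qed

section \<open>The single-spike prior\<close>

text \<open>Change of measure under a likelihood ratio bounded on \<open>A\<close>. It serves the
  spikes, with \<open>A\<close> cutting off large observations, and the grid approximation of
  parameters, with \<open>A\<close> the whole space.\<close>

lemma obs_law_dominated:
  assumes \<mu>: "\<And>i. i < n \<Longrightarrow> 1 \<le> \<mu> i" and \<nu>: "\<And>i. i < n \<Longrightarrow> 1 \<le> \<nu> i"
    and h [measurable]: "h \<in> borel_measurable (PiM {..<n} (\<lambda>_. borel))"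
    and A [measurable]: "A \<in> sets (PiM {..<n} (\<lambda>_. borel))"
    and dom: "\<And>x. x \<in> A \<Longrightarrow> (\<Prod>i<n. ennreal (exponential_density (1 / \<mu> i) (x i)))
      \<le> C * (\<Prod>i<n. ennreal (exponential_density (1 / \<nu> i) (x i)))"
  shows "(\<integral>\<^sup>+x. h x * indicator A x \<partial>obs_law n \<mu>) \<le> C * (\<integral>\<^sup>+x. h x \<partial>obs_law n \<nu>)"
proof -
  let ?L = "PiM {..<n} (\<lambda>_. lborel :: real measure)"
  have L: "sets ?L = sets (PiM {..<n} (\<lambda>_. borel))" by (intro sets_PiM_cong) auto
  have [measurable]: "h \<in> borel_measurable ?L" "A \<in> sets ?L"
    using h A by (auto simp: L cong: measurable_cong_sets[OF L refl])
  have "(\<integral>\<^sup>+x. h x * indicator A x \<partial>obs_law n \<mu>)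
      = (\<integral>\<^sup>+x. (\<Prod>i<n. ennreal (exponential_density (1 / \<mu> i) (x i))) * (h x * indicator A x) \<partial>?L)"
    by (subst obs_law_eq_density[OF \<mu>], assumption, subst nn_integral_density) auto
  also have "\<dots> \<le> (\<integral>\<^sup>+x. C * ((\<Prod>i<n. ennreal (exponential_density (1 / \<nu> i) (x i))) * h x) \<partial>?L)"
  proof (rule nn_integral_mono)
    fix x
    show "(\<Prod>i<n. ennreal (exponential_density (1 / \<mu> i) (x i))) * (h x * indicator A x)
        \<le> C * ((\<Prod>i<n. ennreal (exponential_density (1 / \<nu> i) (x i))) * h x)"
      using mult_right_mono[OF dom[of x], of "h x"] by (cases "x \<in> A") (auto simp: mult_ac)
  qed
  also have "\<dots> = C * (\<integral>\<^sup>+x. (\<Prod>i<n. ennreal (exponential_density (1 / \<nu> i) (x i))) * h x \<partial>?L)"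
    by (intro nn_integral_cmult) auto
  also have "(\<integral>\<^sup>+x. (\<Prod>i<n. ennreal (exponential_density (1 / \<nu> i) (x i))) * h x \<partial>?L) = (\<integral>\<^sup>+x. h x \<partial>obs_law n \<nu>)"
    by (subst obs_law_eq_density[OF \<nu>], assumption, subst nn_integral_density) auto
  finally show ?thesis .
qed

definition spike :: "nat \<Rightarrow> real \<Rightarrow> nat \<Rightarrow> nat \<Rightarrow> real" where
  "spike m M j = (\<lambda>i\<in>{..<m}. if i = j then M else 1)"

lemma spike_ge_1: "1 \<le> M \<Longrightarrow> i < m \<Longrightarrow> 1 \<le> spike m M j i"
  by (simp add: spike_def)

text \<open>Only the coordinates i and j differ. The normalising factors 1 / M cancel, and the
  likelihood ratio is exp ((1 - 1 / M) (x i - x j)), at most exp (x i) for nonnegative observations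
  and hence at most exp (K M) on the event.\<close>

lemma spike_dominated:
  assumes M: "1 \<le> M" and ij: "i < m" "j < m" "i \<noteq> j"
    and h [measurable]: "h \<in> borel_measurable (PiM {..<m} (\<lambda>_. borel))"
  shows "(\<integral>\<^sup>+x. h x * indicator {x \<in> space (PiM {..<m} (\<lambda>_. borel)). x i \<le> K * M} x \<partial>obs_law m (spike m M i))
    \<le> ennreal (exp (K * M)) * (\<integral>\<^sup>+x. h x \<partial>obs_law m (spike m M j))"
proof (rule obs_law_dominated)
  show "{x \<in> space (PiM {..<m} (\<lambda>_. borel)). x i \<le> K * M} \<in> sets (PiM {..<m} (\<lambda>_. borel))"
    by measurable (use ij in simp)
  fix x :: "nat \<Rightarrow> real"
  assume "x \<in> {x \<in> space (PiM {..<m} (\<lambda>_. borel)). x i \<le> K * M}"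
  then have xi: "x i \<le> K * M" by simp
  let ?e = "\<lambda>j k. ennreal (exponential_density (1 / spike m M j k) (x k))"
  have split: "(\<Prod>k<m. ?e l k) = ?e l i * ?e l j * (\<Prod>k\<in>{..<m} - {i, j}. ?e l k)" for l
  proof -
    have "(\<Prod>k<m. ?e l k) = ?e l i * (\<Prod>k\<in>{..<m} - {i}. ?e l k)" using ij by (simp add: prod.remove)
    also have "(\<Prod>k\<in>{..<m} - {i}. ?e l k) = ?e l j * (\<Prod>k\<in>{..<m} - {i} - {j}. ?e l k)"
      using ij by (intro prod.remove) auto
    also have "{..<m} - {i} - {j} = {..<m} - {i, j}" by auto
    finally show ?thesis by (simp add: mult_ac)
  qed
  have rest: "(\<Prod>k\<in>{..<m} - {i, j}. ?e i k) = (\<Prod>k\<in>{..<m} - {i, j}. ?e j k)"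
    by (intro prod.cong) (auto simp: spike_def)
  have "exponential_density (1 / M) (x i) * exponential_density 1 (x j)
      \<le> exp (K * M) * (exponential_density 1 (x i) * exponential_density (1 / M) (x j))"
  proof (cases "0 \<le> x i \<and> 0 \<le> x j")
    case True
    have "exp (- x i / M) \<le> exp (K * M - x i)"
      using True xi M by simp (smt (verit) divide_nonneg_pos)
    moreover have "exp (- x j) \<le> exp (- x j / M)"
      using True M mult_right_mono[of 1 M "x j"] by (simp add: field_simps)
    ultimately have "exp (- x i / M) * exp (- x j) \<le> exp (K * M - x i) * exp (- x j / M)"
      by (intro mult_mono) auto
    then have "exp (- x i / M) * exp (- x j) / M \<le> exp (K * M) * exp (- x i) * exp (- x j / M) / M"
      using M by (intro divide_right_mono) (auto simp flip: exp_add)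
    then show ?thesis using True by (simp add: exponential_density_def mult_ac)
  qed (auto simp: exponential_density_def)
  then have "?e i i * ?e i j \<le> ennreal (exp (K * M)) * (?e j i * ?e j j)"
    using ij M by (simp add: spike_def exponential_density_nonneg flip: ennreal_mult)
  then show "(\<Prod>k<m. ?e i k) \<le> ennreal (exp (K * M)) * (\<Prod>k<m. ?e j k)"
    unfolding split rest using mult_right_mono by (fastforce simp: mult.assoc)
qed (use M in \<open>auto simp: spike_ge_1\<close>)

lemma spike_prob:
  assumes M: "1 \<le> M" and i: "i < m" and K: "0 \<le> K"
  shows "(\<integral>\<^sup>+x. indicator {x \<in> space (PiM {..<m} (\<lambda>_. borel)). x i \<le> K * M} x \<partial>obs_law m (spike m M i)) = ennreal (1 - exp (- K))"
proof -
  have "(\<integral>\<^sup>+x. indicator {x \<in> space (PiM {..<m} (\<lambda>_. borel)). x i \<le> K * M} x \<partial>obs_law m (spike m M i))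
     = (\<integral>\<^sup>+x. indicator {..K * M} (x i) \<partial>obs_law m (spike m M i))"
    by (intro nn_integral_cong) (auto simp: indicator_def space_PiM space_obs_law)
  also have "\<dots> = (\<integral>\<^sup>+x. indicator {..K * M} x \<partial>density lborel (\<lambda>x. ennreal (exponential_density (1 / M) x)))"
    using i M by (subst obs_law_component) (auto simp: spike_ge_1, auto simp: spike_def)
  also have "\<dots> = emeasure (density lborel (\<lambda>x. ennreal (exponential_density (1 / M) x))) {..K * M}"
    by (intro nn_integral_indicator) auto
  also have "\<dots> = ennreal (1 - exp (- K))"
    using M K by (subst emeasure_erlang_density) (auto simp: erlang_CDF_0)
  finally show ?thesis .
qed

text \<open>Guessing between \<theta> with weight 1 and 0 with weight w: the best compromise is y =
  \<theta> / (1 + w), and the left-hand side is its cost.\<close>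

lemma quadratic_tradeoff:
  fixes y \<theta> w :: real
  assumes "0 \<le> w"
  shows "\<theta>\<^sup>2 * (w / (1 + w)) \<le> (y - \<theta>)\<^sup>2 + w * y\<^sup>2"
proof -
  have "(y - \<theta>)\<^sup>2 + w * y\<^sup>2 - \<theta>\<^sup>2 * (w / (1 + w)) = ((1 + w) * y - \<theta>)\<^sup>2 / (1 + w)"
    using assms by (simp add: field_simps power2_eq_square)
  also have "\<dots> \<ge> 0" using assms by simp
  finally show ?thesis by simp
qed

text \<open>A two-point problem for coordinate i, which carries the spike under one law and none
  under the other. On the event x i \<le> K M, of probability 1 - exp (- K), the second law with
  weight b has at least w times the density of the first, so both errors can be charged pointwise to
  the first law.\<close>

lemma spike_pair_bound:
  assumes M: "1 \<le> M" and ij: "i < m" "j < m" "i \<noteq> j" and K: "0 \<le> K" and b: "0 \<le> b"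
    and f [measurable]: "f \<in> borel_measurable (PiM {..<m} (\<lambda>_. borel))"
  defines "w \<equiv> b * exp (- (K * M))"
  shows "ennreal (\<theta>\<^sup>2 * (w / (1 + w)) * (1 - exp (- K))) \<le>
    (\<integral>\<^sup>+x. ennreal ((f x - \<theta>)\<^sup>2) \<partial>obs_law m (spike m M i)) + ennreal b * (\<integral>\<^sup>+x. ennreal ((f x)\<^sup>2) \<partial>obs_law m (spike m M j))"
proof -
  let ?P = "obs_law m (spike m M i)" and ?Q = "obs_law m (spike m M j)"
  let ?A = "{x \<in> space (PiM {..<m} (\<lambda>_. borel)). x i \<le> K * M}"
  have w: "0 \<le> w" using b by (simp add: w_def)
  have A[measurable]: "?A \<in> sets ?P" unfolding sets_obs_law by measurable (use ij in simp)
  have "ennreal (\<theta>\<^sup>2 * (w / (1 + w)) * (1 - exp (- K))) = ennreal (\<theta>\<^sup>2 * (w / (1 + w))) * (\<integral>\<^sup>+x. indicator ?A x \<partial>?P)"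
    using w K by (subst spike_prob[OF M ij(1) K], intro ennreal_mult) auto
  also have "\<dots> = (\<integral>\<^sup>+x. ennreal (\<theta>\<^sup>2 * (w / (1 + w))) * indicator ?A x \<partial>?P)"
    by (intro nn_integral_cmult[symmetric]) auto
  also have "\<dots> \<le> (\<integral>\<^sup>+x. ennreal ((f x - \<theta>)\<^sup>2) + ennreal w * (ennreal ((f x)\<^sup>2) * indicator ?A x) \<partial>?P)"
  proof (rule nn_integral_mono)
    fix x
    show "ennreal (\<theta>\<^sup>2 * (w / (1 + w))) * indicator ?A x \<le> ennreal ((f x - \<theta>)\<^sup>2) + ennreal w * (ennreal ((f x)\<^sup>2) * indicator ?A x)"
      using quadratic_tradeoff[OF w, of \<theta> "f x"] w
      by (cases "x \<in> ?A") (auto simp flip: ennreal_mult ennreal_plus intro!: ennreal_leI)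
  qed
  also have "\<dots> = (\<integral>\<^sup>+x. ennreal ((f x - \<theta>)\<^sup>2) \<partial>?P) + ennreal w * (\<integral>\<^sup>+x. ennreal ((f x)\<^sup>2) * indicator ?A x \<partial>?P)"
    by (subst nn_integral_add) (auto simp: nn_integral_cmult)
  also have "ennreal w * (\<integral>\<^sup>+x. ennreal ((f x)\<^sup>2) * indicator ?A x \<partial>?P)
      \<le> ennreal w * (ennreal (exp (K * M)) * (\<integral>\<^sup>+x. ennreal ((f x)\<^sup>2) \<partial>?Q))"
    using ij by (intro mult_left_mono spike_dominated[OF M]) auto
  also have "\<dots> = ennreal b * (\<integral>\<^sup>+x. ennreal ((f x)\<^sup>2) \<partial>?Q)"
  proof -
    have "ennreal w * ennreal (exp (K * M)) = ennreal b"
      using w by (simp add: w_def mult.assoc flip: ennreal_mult exp_add)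
    then show ?thesis by (simp add: mult.assoc[symmetric])
  qed
  finally show ?thesis by (simp add: add_left_mono)
qed

text \<open>The m - 1 locations of the spike other than i act together as the alternative without a
  spike at i. Their number competes with the likelihood ratio exp (K M); if it wins, w is large and
  nearly the whole (ln M)^2 is lost.\<close>

lemma bayes_lower_spike:
  assumes M: "1 < M" and m: "2 \<le> m" and K: "0 \<le> K" and c: "ln M powr p \<le> c"
  defines "w \<equiv> (real m - 1) * exp (- (K * M))"
  shows "bayes_lower p m c ((ln M)\<^sup>2 * (w / (1 + w)) * (1 - exp (- K)))"
proof -
  define \<kappa> where "\<kappa> = (ln M)\<^sup>2 * (w / (1 + w)) * (1 - exp (- K))"
  have w: "0 \<le> w" using m by (simp add: w_def)
  have inj: "inj_on (spike m M) {..<m}"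
  proof (rule inj_onI)
    fix i j assume "i \<in> {..<m}" "j \<in> {..<m}" "spike m M i = spike m M j"
    then have "i < m" "spike m M i i = spike m M j i" by simp_all
    then show "i = j" using M by (simp add: spike_def split: if_splits)
  qed
  have "bayes_lower p m c \<kappa>" unfolding bayes_lower_def
  proof (intro exI[of _ "spike m M ` {..<m}"] exI[of _ "\<lambda>_. 1 / real m"] conjI ballI)
    show "spike m M ` {..<m} \<subseteq> budget_set p m c"
    proof safe
      fix j assume j: "j < m"
      have "(\<Sum>i<m. ln (spike m M j i) powr p) = (\<Sum>i<m. if i = j then ln M powr p else 0)"
        by (intro sum.cong) (auto simp: spike_def)
      also have "\<dots> = ln M powr p" using j by simp
      finally show "spike m M j \<in> budget_set p m c"
        using M c by (auto simp: budget_set_def spike_ge_1) (simp add: spike_def)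
    qed
    show "sum (\<lambda>_. 1 / real m) (spike m M ` {..<m}) = 1"
      using m by (simp add: card_image[OF inj])
    fix u assume u: "u \<in> log_estimators m"
    let ?J = "\<lambda>j i. \<integral>\<^sup>+x. ennreal ((u x i - ln (spike m M j i))\<^sup>2) \<partial>obs_law m (spike m M j)"
    have row: "ennreal \<kappa> \<le> (\<Sum>j<m. ?J j i)" if i: "i < m" for i
    proof -
      have ui: "(\<lambda>x. u x i) \<in> borel_measurable (PiM {..<m} (\<lambda>_. borel))"
        using u i by (simp add: log_estimators_def)
      have card: "card ({..<m} - {i}) = m - 1" using i by simp
      \<comment> \<open>With weight b = m - 1 on each alternative j, averaging these m - 1
        inequalities gives every location weight one, as in the uniform prior.\<close>
      have pair: "ennreal \<kappa> \<le> ?J i i + ennreal (real m - 1) * ?J j i" if "j \<in> {..<m} - {i}" for j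
        using spike_pair_bound[OF _ i, of M j K "real m - 1" "\<lambda>x. u x i" "ln M"] M K m that ui i
        by (simp add: \<kappa>_def w_def spike_def)
      have "of_nat (m - 1) * ennreal \<kappa> = (\<Sum>j\<in>{..<m} - {i}. ennreal \<kappa>)" by (simp only: sum_constant card)
      also have "\<dots> \<le> (\<Sum>j\<in>{..<m} - {i}. ?J i i + ennreal (real m - 1) * ?J j i)"
        by (intro sum_mono pair)
      also have "\<dots> = of_nat (m - 1) * (?J i i + (\<Sum>j\<in>{..<m} - {i}. ?J j i))"
        using m by (simp only: sum.distrib sum_constant card sum_distrib_left distrib_left)
          (simp add: of_nat_diff ennreal_of_nat_eq_real_of_nat)
      finally have "ennreal \<kappa> \<le> ?J i i + (\<Sum>j\<in>{..<m} - {i}. ?J j i)"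
        using m by (subst (asm) ennreal_mult_le_mult_iff) auto
      also have "\<dots> = (\<Sum>j<m. ?J j i)" using i by (simp add: sum.remove[of "{..<m}" i])
      finally show ?thesis .
    qed
    have "ennreal \<kappa> = ennreal (1 / real m) * (of_nat m * ennreal \<kappa>)"
      using m by (simp add: ennreal_of_nat_eq_real_of_nat mult.assoc[symmetric] flip: ennreal_mult')
    also have "\<dots> = ennreal (1 / real m) * (\<Sum>i<m. ennreal \<kappa>)" by simp
    also have "\<dots> \<le> ennreal (1 / real m) * (\<Sum>i<m. \<Sum>j<m. ?J j i)"
      by (intro mult_left_mono sum_mono row) auto
    also have "(\<Sum>i<m. \<Sum>j<m. ?J j i) = (\<Sum>j<m. total_risk m u (spike m M j))"
      by (subst sum.swap) (simp add: total_risk_eq_sum[OF u])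
    also have "ennreal (1 / real m) * \<dots> = (\<Sum>\<mu>\<in>spike m M ` {..<m}. ennreal (1 / real m) * total_risk m u \<mu>)"
      by (subst sum.reindex[OF inj]) (simp add: sum_distrib_left)
    finally show "ennreal \<kappa> \<le> (\<Sum>\<mu>\<in>spike m M ` {..<m}. ennreal (1 / real m) * total_risk m u \<mu>)" .
  qed auto
  then show ?thesis by (simp add: \<kappa>_def)
qed

section \<open>The minimax theorem\<close>

lemma clamp_square_le:
  fixes y \<theta> D :: real
  assumes "0 \<le> \<theta>" "\<theta> \<le> D"
  shows "(max 0 (min D y) - \<theta>)\<^sup>2 \<le> (y - \<theta>)\<^sup>2"
  using assms by (intro abs_le_square_iff[THEN iffD1]) auto

lemma convex_square:
  fixes a b \<theta> \<alpha> :: real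
  assumes "0 \<le> \<alpha>" "\<alpha> \<le> 1"
  shows "((1 - \<alpha>) * a + \<alpha> * b - \<theta>)\<^sup>2 \<le> (1 - \<alpha>) * (a - \<theta>)\<^sup>2 + \<alpha> * (b - \<theta>)\<^sup>2"
proof -
  have "(1 - \<alpha>) * (a - \<theta>)\<^sup>2 + \<alpha> * (b - \<theta>)\<^sup>2 - ((1 - \<alpha>) * a + \<alpha> * b - \<theta>)\<^sup>2 = \<alpha> * (1 - \<alpha>) * (a - b)\<^sup>2"
    by (simp add: power2_eq_square algebra_simps)
  also have "\<dots> \<ge> 0" using assms by simp
  finally show ?thesis by simp
qed

lemma budget_set_ln_le:
  assumes p: "0 < p" and \<mu>: "\<mu> \<in> budget_set p n c" and i: "i < n"
  shows "ln (\<mu> i) \<le> c powr (1 / p)"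
proof -
  have "ln (\<mu> i) powr p \<le> (\<Sum>i<n. ln (\<mu> i) powr p)"
    using i by (intro member_le_sum) auto
  also have "\<dots> \<le> c" using \<mu> by (simp add: budget_set_def)
  finally have "(ln (\<mu> i) powr p) powr (1 / p) \<le> c powr (1 / p)"
    using p by (intro powr_mono2) auto
  then show ?thesis using p budget_setD[OF \<mu> i] by (simp add: powr_powr)
qed

lemma total_risk_mono:
  assumes "\<And>x i. i < n \<Longrightarrow> (u x i - ln (\<mu> i))\<^sup>2 \<le> (v x i - ln (\<mu> i))\<^sup>2"
  shows "total_risk n u \<mu> \<le> total_risk n v \<mu>"
  unfolding total_risk_def using assms by (intro nn_integral_mono sum_mono ennreal_leI) auto

lemma total_risk_bounded:
  assumes \<mu>: "\<And>i. i < n \<Longrightarrow> 1 \<le> \<mu> i" and b: "\<And>x i. i < n \<Longrightarrow> (u x i - ln (\<mu> i))\<^sup>2 \<le> B"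
  shows "total_risk n u \<mu> \<le> ennreal (real n * B)"
proof -
  interpret prob_space "obs_law n \<mu>" by (rule prob_space_obs_law) (rule \<mu>)
  have "total_risk n u \<mu> \<le> (\<integral>\<^sup>+x. (\<Sum>i<n. ennreal B) \<partial>obs_law n \<mu>)"
    unfolding total_risk_def using b by (intro nn_integral_mono sum_mono ennreal_leI) auto
  also have "\<dots> = ennreal (real n * B)"
    by (simp add: emeasure_space_1 ennreal_mult' ennreal_of_nat_eq_real_of_nat)
  finally show ?thesis .
qed

text \<open>Since the loss is convex, averaging two estimators does at least as well as randomising
  between them; this supplies the mixing hypothesis of \<open>finite_minimax\<close>.\<close>

lemma total_risk_convex:
  assumes f: "f \<in> log_estimators n" and g: "g \<in> log_estimators n" and \<alpha>: "0 \<le> \<alpha>" "\<alpha> \<le> 1"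
  shows "total_risk n (\<lambda>x i. (1 - \<alpha>) * f x i + \<alpha> * g x i) \<mu>
    \<le> ennreal (1 - \<alpha>) * total_risk n f \<mu> + ennreal \<alpha> * total_risk n g \<mu>"
proof -
  have [measurable]: "(\<lambda>x. f x i) \<in> borel_measurable (obs_law n \<mu>)" "(\<lambda>x. g x i) \<in> borel_measurable (obs_law n \<mu>)"
    if "i < n" for i
    using f g that by (auto simp: log_estimators_def)
  have "total_risk n (\<lambda>x i. (1 - \<alpha>) * f x i + \<alpha> * g x i) \<mu> \<le>
      (\<integral>\<^sup>+x. (\<Sum>i<n. ennreal (1 - \<alpha>) * ennreal ((f x i - ln (\<mu> i))\<^sup>2) + ennreal \<alpha> * ennreal ((g x i - ln (\<mu> i))\<^sup>2)) \<partial>obs_law n \<mu>)"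
    unfolding total_risk_def
  proof (intro nn_integral_mono sum_mono)
    fix x i
    show "ennreal (((1 - \<alpha>) * f x i + \<alpha> * g x i - ln (\<mu> i))\<^sup>2)
      \<le> ennreal (1 - \<alpha>) * ennreal ((f x i - ln (\<mu> i))\<^sup>2) + ennreal \<alpha> * ennreal ((g x i - ln (\<mu> i))\<^sup>2)"
      using convex_square[OF \<alpha>, of "f x i" "g x i" "ln (\<mu> i)"] \<alpha>
      by (simp flip: ennreal_mult ennreal_plus)
  qed
  also have "\<dots> = (\<integral>\<^sup>+x. ennreal (1 - \<alpha>) * (\<Sum>i<n. ennreal ((f x i - ln (\<mu> i))\<^sup>2))
      + ennreal \<alpha> * (\<Sum>i<n. ennreal ((g x i - ln (\<mu> i))\<^sup>2)) \<partial>obs_law n \<mu>)"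
    by (simp add: sum.distrib sum_distrib_left del: sum_ennreal)
  also have "\<dots> = ennreal (1 - \<alpha>) * total_risk n f \<mu> + ennreal \<alpha> * total_risk n g \<mu>"
    unfolding total_risk_def by (subst nn_integral_add) (auto simp: nn_integral_cmult simp del: sum_ennreal)
  finally show ?thesis .
qed

text \<open>In each coordinate the density ratio is \<open>\<nu> i / \<mu> i\<close>, at most exp h,
  times an exponential that does not exceed 1 because \<mu> i \<le> \<nu> i.\<close>

lemma obs_law_scale_dominated:
  assumes \<mu>: "\<And>i. i < n \<Longrightarrow> 1 \<le> \<mu> i" and \<nu>: "\<And>i. i < n \<Longrightarrow> \<mu> i \<le> \<nu> i \<and> \<nu> i \<le> exp h * \<mu> i"
    and g: "g \<in> borel_measurable (PiM {..<n} (\<lambda>_. borel))"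
  shows "(\<integral>\<^sup>+x. g x \<partial>obs_law n \<mu>) \<le> ennreal (exp (real n * h)) * (\<integral>\<^sup>+x. g x \<partial>obs_law n \<nu>)"
proof -
  have \<nu>1: "1 \<le> \<nu> i" if "i < n" for i using \<mu> \<nu> that by (meson order_trans)
  have "(\<integral>\<^sup>+x. g x * indicator (space (PiM {..<n} (\<lambda>_. borel))) x \<partial>obs_law n \<mu>)
      \<le> ennreal (exp (real n * h)) * (\<integral>\<^sup>+x. g x \<partial>obs_law n \<nu>)"
  proof (rule obs_law_dominated)
    fix x :: "nat \<Rightarrow> real"
    have "(\<Prod>i<n. ennreal (exponential_density (1 / \<mu> i) (x i)))
        \<le> (\<Prod>i<n. ennreal (exp h) * ennreal (exponential_density (1 / \<nu> i) (x i)))"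
    proof (rule prod_mono_ennreal)
      fix i assume i: "i \<in> {..<n}"
      have m: "0 < \<mu> i" "0 < \<nu> i" "\<mu> i \<le> \<nu> i" "\<nu> i \<le> exp h * \<mu> i" using \<mu>[of i] \<nu>[of i] i by auto
      have "exponential_density (1 / \<mu> i) (x i) \<le> exp h * exponential_density (1 / \<nu> i) (x i)"
      proof (cases "0 \<le> x i")
        case True
        have "1 / \<mu> i \<le> exp h / \<nu> i" using m by (simp add: field_simps)
        moreover have "exp (- x i / \<mu> i) \<le> exp (- x i / \<nu> i)"
          using m True by (simp add: frac_le)
        ultimately have "1 / \<mu> i * exp (- x i / \<mu> i) \<le> exp h / \<nu> i * exp (- x i / \<nu> i)"
          using m by (intro mult_mono) auto
        then show ?thesis using True by (simp add: exponential_density_def)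
      qed (simp add: exponential_density_def)
      then show "ennreal (exponential_density (1 / \<mu> i) (x i)) \<le> ennreal (exp h) * ennreal (exponential_density (1 / \<nu> i) (x i))"
        by (simp add: ennreal_leI flip: ennreal_mult')
    qed
    also have "\<dots> = ennreal (exp (real n * h)) * (\<Prod>i<n. ennreal (exponential_density (1 / \<nu> i) (x i)))"
      by (simp add: prod.distrib ennreal_power exp_of_nat_mult)
    finally show "(\<Prod>i<n. ennreal (exponential_density (1 / \<mu> i) (x i)))
        \<le> ennreal (exp (real n * h)) * (\<Prod>i<n. ennreal (exponential_density (1 / \<nu> i) (x i)))" .
  qed (use \<mu> \<nu>1 g in auto)
  also have "(\<integral>\<^sup>+x. g x * indicator (space (PiM {..<n} (\<lambda>_. borel))) x \<partial>obs_law n \<mu>) = (\<integral>\<^sup>+x. g x \<partial>obs_law n \<mu>)"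
    by (intro nn_integral_cong) (simp add: space_obs_law space_PiM)
  finally show ?thesis .
qed

text \<open>Parameters are rounded up to a grid, because only then is the density of the observations
  at the true parameter bounded by a multiple of the one at the grid point; this
  costs an enlargement of the budget.\<close>

lemma minimax_le_bayes:
  assumes p: "0 < p" and c: "0 \<le> c" "c < c'" and e: "0 < e"
    and \<beta>: "0 \<le> \<beta>" "\<And>b. bayes_lower p n c' b \<Longrightarrow> b \<le> \<beta>"
  shows "\<exists>u\<in>log_estimators n. \<forall>\<mu>\<in>budget_set p n c. total_risk n u \<mu> \<le> ennreal (\<beta> + e)"
proof -
  define D where "D = c' powr (1 / p)"
  have D: "0 \<le> D" by (simp add: D_def)
  \<comment> \<open>The spare budget is shared among the coordinates; the 1 covers the case n =
    0.\<close>
  define \<delta> where "\<delta> = (c' - c) / (real n + 1)"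
  have \<delta>: "0 < \<delta>" "real n * \<delta> \<le> c' - c" using c by (auto simp: \<delta>_def field_simps)
  \<comment> \<open>\<open>D\<close> bounds the logarithms of the parameters, and rounding up by h <
    1 stays below \<open>D + 1\<close>. Uniform continuity covers exponents below 1, for which the
    power has unbounded slope at 0.\<close>
  have "uniformly_continuous_on {0..D + 1} (\<lambda>x. x powr p)"
    using p by (intro compact_uniformly_continuous continuous_on_powr') (auto intro!: continuous_intros)
  then obtain d where d: "0 < d" "\<And>x y. x \<in> {0..D + 1} \<Longrightarrow> y \<in> {0..D + 1} \<Longrightarrow> dist y x < d \<Longrightarrow> dist (y powr p) (x powr p) < \<delta>"
    using \<delta>(1) unfolding uniformly_continuous_on_def by metis
  \<comment> \<open>The two costs of a mesh h: the change of measure multiplies the risk by exp (n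
    h), and moving the target changes each squared error by at most 2 D h. As n is fixed, both fit
    into the second half of e.\<close>
  have "((\<lambda>h. exp (real n * h) * (\<beta> + e / 2 + real n * (2 * D * h))) \<longlongrightarrow> exp (real n * 0) * (\<beta> + e / 2 + real n * (2 * D * 0))) (at_right 0)"
    by (intro tendsto_intros)
  then have "\<forall>\<^sub>F h in at_right 0. exp (real n * h) * (\<beta> + e / 2 + real n * (2 * D * h)) < \<beta> + e"
    using e by (intro order_tendstoD) auto
  moreover have "\<forall>\<^sub>F h in at_right 0. 0 < h \<and> h < min d 1"
    using eventually_at_right_real[of 0 "min d 1"] d(1) by auto
  ultimately have "\<forall>\<^sub>F h in at_right 0. exp (real n * h) * (\<beta> + e / 2 + real n * (2 * D * h)) < \<beta> + e \<and> 0 < h \<and> h < min d 1"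
    by (rule eventually_conj)
  then obtain h where h: "exp (real n * h) * (\<beta> + e / 2 + real n * (2 * D * h)) < \<beta> + e" "0 < h" "h < d" "h < 1"
    using eventually_happens'[OF trivial_limit_at_right_real] by fastforce
  define N where "N = nat \<lceil>D / h\<rceil>"
  define F where "F = {\<kappa> \<in> budget_set p n c'. \<forall>i<n. \<kappa> i \<in> (\<lambda>k. exp (h * real k)) ` {..N}}"
  have fin: "finite F"
  proof (rule finite_subset)
    show "F \<subseteq> PiE {..<n} (\<lambda>_. (\<lambda>k. exp (h * real k)) ` {..N})"
      by (intro subsetI) (simp add: F_def budget_set_def PiE_iff)
  qed (auto intro: finite_PiE)
  define E where "E = {u \<in> log_estimators n. \<forall>x. \<forall>i<n. 0 \<le> u x i \<and> u x i \<le> D}"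
  have \<theta>: "0 \<le> ln (\<mu> i)" "ln (\<mu> i) \<le> D" if "\<mu> \<in> budget_set p n c'" "i < n" for \<mu> i
    using budget_setD[OF that] budget_set_ln_le[OF p that] by (auto simp: D_def)
  have bounded: "total_risk n u \<mu> \<le> ennreal (real n * D\<^sup>2)" if "u \<in> E" "\<mu> \<in> budget_set p n c'" for u \<mu>
  proof (rule total_risk_bounded)
    fix x i assume i: "i < n"
    then have "\<bar>u x i - ln (\<mu> i)\<bar> \<le> \<bar>D\<bar>" using \<theta>[OF that(2) i] that(1) D by (auto simp: E_def abs_le_iff) (smt (verit))+
    then show "(u x i - ln (\<mu> i))\<^sup>2 \<le> D\<^sup>2" by (simp only: abs_le_square_iff)
  qed (rule budget_setD[OF that(2)])
  have fin_risk: "total_risk n u \<mu> = ennreal (enn2real (total_risk n u \<mu>))" if "u \<in> E" "\<mu> \<in> budget_set p n c'" for u \<mu>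
    using order_le_less_trans[OF bounded[OF that] ennreal_less_top] by simp
  \<comment> \<open>One quarter of e makes \<open>\<beta> + e / 4\<close> exceed every Bayes lower
    bound, so that each prior on the grid has a good reply; the other is the slack of
    \<open>finite_minimax\<close>.\<close>
  have "\<exists>f\<in>E. \<forall>\<mu>\<in>F. enn2real (total_risk n f \<mu>) \<le> (\<beta> + e / 4) + e / 4"
  proof (rule finite_minimax[OF fin, where C = "real n * D\<^sup>2"])
    have "(\<lambda>_ _. 0) \<in> E" using D by (auto simp: E_def log_estimators_def)
    then show "E \<noteq> {}" by blast
    show "0 \<le> enn2real (total_risk n f m) \<and> enn2real (total_risk n f m) \<le> real n * D\<^sup>2" if "f \<in> E" "m \<in> F" for f m
      using bounded[of f m] that by (auto simp: F_def intro!: enn2real_leI)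
    show "\<exists>h\<in>E. \<forall>m\<in>F. enn2real (total_risk n h m) \<le> (1 - \<alpha>) * enn2real (total_risk n f m) + \<alpha> * enn2real (total_risk n g m)"
      if fg: "f \<in> E" "g \<in> E" and \<alpha>: "0 \<le> \<alpha>" "\<alpha> \<le> 1" for f g \<alpha>
    proof (intro bexI[of _ "\<lambda>x i. (1 - \<alpha>) * f x i + \<alpha> * g x i"] ballI)
      fix m assume m: "m \<in> F"
      have "total_risk n (\<lambda>x i. (1 - \<alpha>) * f x i + \<alpha> * g x i) m
        \<le> ennreal (1 - \<alpha>) * ennreal (enn2real (total_risk n f m)) + ennreal \<alpha> * ennreal (enn2real (total_risk n g m))"
        using total_risk_convex[of f n g \<alpha> m] fg \<alpha> m fin_risk[of f m] fin_risk[of g m] by (simp add: E_def F_def)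
      also have "\<dots> = ennreal ((1 - \<alpha>) * enn2real (total_risk n f m) + \<alpha> * enn2real (total_risk n g m))"
        using \<alpha> by (simp add: ennreal_mult ennreal_plus)
      finally show "enn2real (total_risk n (\<lambda>x i. (1 - \<alpha>) * f x i + \<alpha> * g x i) m) \<le> (1 - \<alpha>) * enn2real (total_risk n f m) + \<alpha> * enn2real (total_risk n g m)"
        using \<alpha> by (intro enn2real_leI) auto
    next
      show "(\<lambda>x i. (1 - \<alpha>) * f x i + \<alpha> * g x i) \<in> E"
        using fg \<alpha> convex_bound_le[of _ D _ "1 - \<alpha>" \<alpha>]
        by (auto simp: E_def log_estimators_def intro!: borel_measurable_add borel_measurable_times)
    qed
    show "\<exists>g\<in>E. (\<Sum>m\<in>F. w m * enn2real (total_risk n g m)) \<le> \<beta> + e / 4"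
      if w: "\<forall>m\<in>F. 0 \<le> w m" "sum w F = 1" for w
    proof -
      have "\<not> bayes_lower p n c' (\<beta> + e / 4)" using \<beta>(2) e by fastforce
      moreover have "F \<subseteq> budget_set p n c'" by (auto simp: F_def)
      ultimately have "\<not> (\<forall>u\<in>log_estimators n. ennreal (\<beta> + e / 4) \<le> (\<Sum>\<mu>\<in>F. ennreal (w \<mu>) * total_risk n u \<mu>))"
        using w fin unfolding bayes_lower_def by blast
      then obtain u where u: "u \<in> log_estimators n"
        "(\<Sum>\<mu>\<in>F. ennreal (w \<mu>) * total_risk n u \<mu>) < ennreal (\<beta> + e / 4)"
        by (auto simp: not_le)
      \<comment> \<open>Truncation to the range of the log-parameters only reduces the error, and
        puts the reply into the uniformly bounded class \<open>E\<close>.\<close>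
      define g where "g x i = max 0 (min D (u x i))" for x i
      have g: "g \<in> E" using u(1) D by (auto simp: E_def g_def log_estimators_def)
      have "ennreal (\<Sum>m\<in>F. w m * enn2real (total_risk n g m)) = (\<Sum>m\<in>F. ennreal (w m) * total_risk n g m)"
        using w fin_risk[OF g] by (subst sum_ennreal[symmetric]) (auto simp: ennreal_mult F_def intro!: sum.cong)
      also have "\<dots> \<le> (\<Sum>\<mu>\<in>F. ennreal (w \<mu>) * total_risk n u \<mu>)"
        using \<theta> unfolding g_def by (intro sum_mono mult_left_mono total_risk_mono clamp_square_le) (auto simp: F_def)
      finally have "ennreal (\<Sum>m\<in>F. w m * enn2real (total_risk n g m)) \<le> ennreal (\<beta> + e / 4)" using u(2) by simp
      then show ?thesis using g \<beta> e by (auto simp: ennreal_le_iff simp del: ennreal_plus)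
    qed
  qed (use e in auto)
  then obtain u where "u \<in> E" "\<forall>\<mu>\<in>F. enn2real (total_risk n u \<mu>) \<le> (\<beta> + e / 4) + e / 4" by blast
  then have u: "u \<in> E" "\<And>\<mu>. \<mu> \<in> F \<Longrightarrow> enn2real (total_risk n u \<mu>) \<le> \<beta> + e / 2" by fastforce+
  show ?thesis
  proof (intro bexI[of _ u] ballI)
    show uL: "u \<in> log_estimators n" using u by (simp add: E_def)
    fix \<mu> assume \<mu>: "\<mu> \<in> budget_set p n c"
    then have \<mu>': "\<mu> \<in> budget_set p n c'" using c by (auto simp: budget_set_def)
    define k where "k i = nat \<lceil>ln (\<mu> i) / h\<rceil>" for i
    define \<nu> where "\<nu> = (\<lambda>i\<in>{..<n}. exp (h * real (k i)))"
    have k: "ln (\<mu> i) \<le> h * real (k i)" "h * real (k i) \<le> ln (\<mu> i) + h" if "i < n" for i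
    proof -
      have "real (k i) = of_int \<lceil>ln (\<mu> i) / h\<rceil>" using \<theta>(1)[OF \<mu>' that] h by (simp add: k_def)
      then have "ln (\<mu> i) / h \<le> real (k i)" "real (k i) \<le> ln (\<mu> i) / h + 1" by linarith+
      then show "ln (\<mu> i) \<le> h * real (k i)" "h * real (k i) \<le> ln (\<mu> i) + h"
        using h by (auto simp: field_simps)
    qed
    have \<nu>1: "\<mu> i \<le> \<nu> i" "\<nu> i \<le> exp h * \<mu> i" if "i < n" for i
    proof -
      have "\<mu> i = exp (ln (\<mu> i))" using budget_setD[OF \<mu> that] by simp
      then show "\<mu> i \<le> \<nu> i" "\<nu> i \<le> exp h * \<mu> i"
        using k[OF that] that by (simp_all add: \<nu>_def) (metis exp_le_cancel_iff, metis add.commute exp_add exp_le_cancel_iff)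
    qed
    have "(\<Sum>i<n. ln (\<nu> i) powr p) \<le> (\<Sum>i<n. ln (\<mu> i) powr p + \<delta>)"
    proof (rule sum_mono)
      fix i assume i: "i \<in> {..<n}"
      then have "dist ((h * real (k i)) powr p) (ln (\<mu> i) powr p) < \<delta>"
        using k[of i] \<theta>[OF \<mu>', of i] h by (intro d(2)) (auto simp: dist_real_def)
      then show "ln (\<nu> i) powr p \<le> ln (\<mu> i) powr p + \<delta>" using i by (simp add: \<nu>_def dist_real_def)
    qed
    also have "\<dots> \<le> c'" using \<mu> \<delta>(2) by (simp add: sum.distrib budget_set_def)
    finally have "(\<Sum>i<n. ln (\<nu> i) powr p) \<le> c'" .
    moreover have "1 \<le> \<nu> i" if "i < n" for i
      using \<nu>1(1)[OF that] budget_setD[OF \<mu> that] by simp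
    ultimately have \<nu>B: "\<nu> \<in> budget_set p n c'"
      by (simp add: budget_set_def \<nu>_def)
    have \<nu>F: "\<nu> \<in> F"
    proof -
      have "k i \<le> N" if "i < n" for i
      proof -
        have "h * real (k i) \<le> D" using \<theta>(2)[OF \<nu>B that] that by (simp add: \<nu>_def)
        then have "real (k i) \<le> D / h" using h by (simp add: field_simps)
        then show ?thesis unfolding N_def by linarith
      qed
      then show ?thesis using \<nu>B by (auto simp: F_def \<nu>_def)
    qed
    interpret prob_space "obs_law n \<nu>" by (rule prob_space_obs_law) (rule budget_setD[OF \<nu>B])
    have um: "(\<lambda>x. u x i) \<in> borel_measurable (PiM {..<n} (\<lambda>_. borel))" if "i < n" for i
      using uL that by (simp add: log_estimators_def)
    have "total_risk n u \<mu> \<le> ennreal (exp (real n * h)) * (\<integral>\<^sup>+x. (\<Sum>i<n. ennreal ((u x i - ln (\<mu> i))\<^sup>2)) \<partial>obs_law n \<nu>)"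
      unfolding total_risk_def
      using um \<nu>1 budget_setD[OF \<mu>]
      by (intro obs_law_scale_dominated borel_measurable_sum) auto
    also have "(\<integral>\<^sup>+x. (\<Sum>i<n. ennreal ((u x i - ln (\<mu> i))\<^sup>2)) \<partial>obs_law n \<nu>)
       \<le> (\<integral>\<^sup>+x. (\<Sum>i<n. ennreal ((u x i - ln (\<nu> i))\<^sup>2)) + ennreal (real n * (2 * D * h)) \<partial>obs_law n \<nu>)"
    proof (rule nn_integral_mono)
      fix x
      have "(\<Sum>i<n. ennreal ((u x i - ln (\<mu> i))\<^sup>2)) \<le> (\<Sum>i<n. ennreal ((u x i - ln (\<nu> i))\<^sup>2) + ennreal (2 * D * h))"
      proof (rule sum_mono)
        fix i assume i: "i \<in> {..<n}"
        have l\<nu>: "ln (\<nu> i) = h * real (k i)" using i by (simp add: \<nu>_def)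
        have "(u x i - ln (\<mu> i))\<^sup>2 = (u x i - ln (\<nu> i))\<^sup>2 + (2 * u x i - ln (\<mu> i) - ln (\<nu> i)) * (ln (\<nu> i) - ln (\<mu> i))"
          by (simp add: power2_eq_square algebra_simps)
        also have "(2 * u x i - ln (\<mu> i) - ln (\<nu> i)) * (ln (\<nu> i) - ln (\<mu> i)) \<le> (2 * D) * (ln (\<nu> i) - ln (\<mu> i))"
          using u(1) i k[of i] l\<nu> \<theta>[OF \<mu>', of i] \<theta>[OF \<nu>B, of i]
          by (intro mult_right_mono) (auto simp: E_def, smt (verit))
        also have "\<dots> \<le> 2 * D * h" using i k[of i] l\<nu> D by (intro mult_left_mono) auto
        finally show "ennreal ((u x i - ln (\<mu> i))\<^sup>2) \<le> ennreal ((u x i - ln (\<nu> i))\<^sup>2) + ennreal (2 * D * h)"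
          using D h by (simp flip: ennreal_plus)
      qed
      also have "\<dots> = (\<Sum>i<n. ennreal ((u x i - ln (\<nu> i))\<^sup>2)) + ennreal (real n * (2 * D * h))"
        using D h by (simp add: sum.distrib ennreal_mult' ennreal_of_nat_eq_real_of_nat del: sum_ennreal)
      finally show "(\<Sum>i<n. ennreal ((u x i - ln (\<mu> i))\<^sup>2)) \<le> (\<Sum>i<n. ennreal ((u x i - ln (\<nu> i))\<^sup>2)) + ennreal (real n * (2 * D * h))" .
    qed
    also have "\<dots> = total_risk n u \<nu> + ennreal (real n * (2 * D * h))"
      unfolding total_risk_def using um
      by (subst nn_integral_add) (auto simp: emeasure_space_1 simp del: sum_ennreal)
    also have "total_risk n u \<nu> \<le> ennreal (\<beta> + e / 2)"
      using fin_risk[OF u(1) \<nu>B] u(2)[OF \<nu>F] by (metis ennreal_leI)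
    also have "ennreal (exp (real n * h)) * (ennreal (\<beta> + e / 2) + ennreal (real n * (2 * D * h)))
        = ennreal (exp (real n * h) * (\<beta> + e / 2 + real n * (2 * D * h)))"
    proof -
      have nn: "0 \<le> \<beta> + e / 2" "0 \<le> real n * (2 * D * h)" using D h e \<beta> by auto
      show ?thesis by (subst ennreal_plus[OF nn, symmetric], subst ennreal_mult'[symmetric]) auto
    qed
    also have "\<dots> \<le> ennreal (\<beta> + e)" using h by (intro ennreal_leI) simp
    finally show "total_risk n u \<mu> \<le> ennreal (\<beta> + e)" by (simp add: mult_left_mono add_right_mono)
  qed
qed

section \<open>Limits\<close>

definition bayes_value :: "real \<Rightarrow> nat \<Rightarrow> real \<Rightarrow> real" where
  "bayes_value p n c = Sup {\<beta>. bayes_lower p n c \<beta>}"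

lemma bayes_lower_zero:
  assumes "0 \<le> c" shows "bayes_lower p n c 0"
  unfolding bayes_lower_def using one_in_budget_set[OF assms, of n p]
  by (intro exI[of _ "{restrict (\<lambda>_. 1) {..<n}}"] exI[of _ "\<lambda>_. 1"]) auto

text \<open>The thresholding estimator with t = 1 serves as a competitor. Its uniform risk bound
  makes the supremum defining \<open>bayes_value\<close> finite and of linear growth.\<close>

lemma bayes_lower_le:
  assumes "bayes_lower p n c b"
  shows "b \<le> (log_moment + 2) * real n"
proof -
  obtain F w where F: "finite F" "F \<subseteq> budget_set p n c" "\<forall>\<mu>\<in>F. 0 \<le> w \<mu>" "sum w F = 1"
    "\<forall>u\<in>log_estimators n. ennreal b \<le> (\<Sum>\<mu>\<in>F. ennreal (w \<mu>) * total_risk n u \<mu>)"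
    using assms unfolding bayes_lower_def by blast
  have "ennreal b \<le> (\<Sum>\<mu>\<in>F. ennreal (w \<mu>) * total_risk n (\<lambda>x i. ln (thresh_est 1 x i)) \<mu>)"
    using F(5) thresh_log_estimator by blast
  also have "\<dots> \<le> (\<Sum>\<mu>\<in>F. ennreal (w \<mu>) * ennreal ((log_moment + 2) * real n))"
  proof (intro sum_mono mult_left_mono)
    fix \<mu> assume "\<mu> \<in> F"
    then have \<mu>: "1 \<le> \<mu> i" if "i < n" for i using F(2) budget_setD that by blast
    have "total_risk n (\<lambda>x i. ln (thresh_est 1 x i)) \<mu> = (\<Sum>i<n. thresh_risk 1 (\<mu> i))"
      by (rule total_risk_thresh) (rule \<mu>)
    also have "\<dots> \<le> (\<Sum>i<n. ennreal (log_moment + 2))"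
      using thresh_risk_uniform[of 1] \<mu> by (intro sum_mono) (simp del: ennreal_plus)
    also have "\<dots> = ennreal ((log_moment + 2) * real n)"
      using log_moment_nonneg by (simp add: ennreal_mult'' ennreal_of_nat_eq_real_of_nat mult.commute del: ennreal_plus)
    finally show "total_risk n (\<lambda>x i. ln (thresh_est 1 x i)) \<mu> \<le> ennreal ((log_moment + 2) * real n)" .
  qed simp
  also have "\<dots> = (\<Sum>\<mu>\<in>F. ennreal (w \<mu>)) * ennreal ((log_moment + 2) * real n)"
    by (simp only: sum_distrib_right)
  also have "(\<Sum>\<mu>\<in>F. ennreal (w \<mu>)) = 1" using F(3,4) by (simp add: sum_ennreal)
  finally show ?thesis using log_moment_nonneg by (simp add: ennreal_le_iff)
qed

lemma bayes_value_upper: "bayes_lower p n c b \<Longrightarrow> b \<le> bayes_value p n c"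
  unfolding bayes_value_def
  by (intro cSup_upper) (auto intro!: bdd_aboveI bayes_lower_le)

lemma bayes_value_least:
  assumes "0 \<le> c" "\<And>b. bayes_lower p n c b \<Longrightarrow> b \<le> B"
  shows "bayes_value p n c \<le> B"
  unfolding bayes_value_def using assms bayes_lower_zero[OF assms(1)] by (intro cSup_least) auto

lemma bayes_value_nonneg: "0 \<le> c \<Longrightarrow> 0 \<le> bayes_value p n c"
  by (intro bayes_value_upper bayes_lower_zero)

lemma bayes_value_bound: "0 \<le> c \<Longrightarrow> bayes_value p n c \<le> (log_moment + 2) * real n"
  by (intro bayes_value_least bayes_lower_le)

lemma bayes_value_append:
  assumes "0 \<le> c" "0 \<le> d"
  shows "bayes_value p n c + bayes_value p m d \<le> bayes_value p (n + m) (c + d)"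
proof -
  have "bayes_value p n c \<le> bayes_value p (n + m) (c + d) - bayes_value p m d"
  proof (rule bayes_value_least[OF assms(1)])
    fix b assume b: "bayes_lower p n c b"
    have "bayes_value p m d \<le> bayes_value p (n + m) (c + d) - b"
    proof (rule bayes_value_least[OF assms(2)])
      fix b' assume "bayes_lower p m d b'"
      then show "b' \<le> bayes_value p (n + m) (c + d) - b"
        using bayes_value_upper[OF bayes_lower_append[OF b]] by fastforce
    qed
    then show "b \<le> bayes_value p (n + m) (c + d) - bayes_value p m d" by simp
  qed
  then show ?thesis by simp
qed

lemma bayes_value_mult:
  assumes "0 \<le> c"
  shows "real q * bayes_value p n c \<le> bayes_value p (q * n) (real q * c)"
proof (induction q)
  case 0 then show ?case using bayes_value_nonneg[of 0] by simp
next
  case (Suc q)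
  have "real (Suc q) * bayes_value p n c \<le> bayes_value p n c + bayes_value p (q * n) (real q * c)"
    using Suc by (simp add: algebra_simps)
  also have "\<dots> \<le> bayes_value p (n + q * n) (c + real q * c)"
    using assms by (intro bayes_value_append) auto
  finally show ?case by (simp add: algebra_simps)
qed

lemma minimax_risk_ge_bayes:
  assumes n: "0 < n" and b: "bayes_lower p n (real n * \<eta> powr p) b"
  shows "ennreal (b / real n) \<le> minimax_risk n p \<eta>"
  unfolding minimax_risk_def
proof (rule INF_greatest)
  fix f assume f: "f \<in> estimators n"
  let ?u = "\<lambda>x i. ln (f x i)" and ?B = "budget_set p n (real n * \<eta> powr p)"
  have u: "?u \<in> log_estimators n" by (rule log_of_estimator[OF f])
  obtain F w where F: "finite F" "F \<subseteq> ?B" "\<forall>\<mu>\<in>F. 0 \<le> w \<mu>" "sum w F = 1"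
    "\<forall>u\<in>log_estimators n. ennreal b \<le> (\<Sum>\<mu>\<in>F. ennreal (w \<mu>) * total_risk n u \<mu>)"
    using b unfolding bayes_lower_def by blast
  have "ennreal b \<le> (\<Sum>\<mu>\<in>F. ennreal (w \<mu>) * total_risk n ?u \<mu>)" using F(5) u by blast
  also have "\<dots> \<le> (\<Sum>\<mu>\<in>F. ennreal (w \<mu>) * (SUP \<mu>\<in>?B. total_risk n ?u \<mu>))"
    using F(2) by (intro sum_mono mult_left_mono SUP_upper) auto
  also have "\<dots> = (\<Sum>\<mu>\<in>F. ennreal (w \<mu>)) * (SUP \<mu>\<in>?B. total_risk n ?u \<mu>)"
    by (simp only: sum_distrib_right)
  also have "(\<Sum>\<mu>\<in>F. ennreal (w \<mu>)) = 1" using F(3,4) by (simp add: sum_ennreal)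
  finally have "ennreal (1 / real n) * ennreal b \<le> ennreal (1 / real n) * (SUP \<mu>\<in>?B. total_risk n ?u \<mu>)"
    by (intro mult_left_mono) auto
  then show "ennreal (b / real n) \<le> max_risk n p \<eta> f"
    by (simp add: max_risk_eq[OF n u] flip: ennreal_mult')
qed

lemma minimax_risk_le_total:
  assumes n: "0 < n" and u: "u \<in> log_estimators n"
    and B: "\<And>\<mu>. \<mu> \<in> budget_set p n (real n * \<eta> powr p) \<Longrightarrow> total_risk n u \<mu> \<le> ennreal B"
  shows "minimax_risk n p \<eta> \<le> ennreal (B / real n)"
proof -
  have "minimax_risk n p \<eta> \<le> max_risk n p \<eta> (\<lambda>x i. exp (u x i))"
    unfolding minimax_risk_def by (rule INF_lower) (rule estimator_of_log[OF u])
  also have "\<dots> = ennreal (1 / real n) * (SUP \<mu>\<in>budget_set p n (real n * \<eta> powr p). total_risk n u \<mu>)"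
    using max_risk_eq[OF n, of "\<lambda>x i. exp (u x i)"] u by simp
  also have "\<dots> \<le> ennreal (1 / real n) * ennreal B"
    using B by (intro mult_left_mono SUP_least) auto
  finally show ?thesis by (simp flip: ennreal_mult')
qed

text \<open>The enlarged budget needed in \<open>minimax_le_bayes\<close> is paid for by adding a small proportion of
  coordinates without any budget, which makes the limiting Bayes value continuous in the budget.\<close>

lemma minimax_risk_limit:
  assumes p: "0 < p" and \<eta>: "0 < \<eta>"
  obtains R where "(\<lambda>n. enn2real (minimax_risk n p \<eta>)) \<longlonglongrightarrow> R"
    and "\<And>n. 0 < n \<Longrightarrow> minimax_risk n p \<eta> < \<top>"
    and "\<And>m b. 0 < m \<Longrightarrow> bayes_lower p m (real m * \<eta> powr p) b \<Longrightarrow> b / real m \<le> R"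
proof -
  define s where "s = \<eta> powr p"
  have s: "0 < s" using \<eta> by (simp add: s_def)
  define a where "a s n = bayes_value p n (real n * s)" for s n
  define R where "R = (SUP n\<in>{1..}. a s n / real n)"
  have a_nonneg: "0 \<le> a s n" if "0 \<le> s" for s n
    unfolding a_def using that by (intro bayes_value_nonneg) auto
  have a_bound: "a s n \<le> (log_moment + 2) * real n" if "0 \<le> s" for s n
    unfolding a_def using that by (intro bayes_value_bound) auto
  have super: "a s m + a s n \<le> a s (m + n)" for m n
    unfolding a_def using bayes_value_append[of "real m * s" "real n * s" p m n] s by (simp add: distrib_right)
  have lim: "(\<lambda>n. a s n / real n) \<longlonglongrightarrow> R" unfolding R_def
    using s by (intro superadditive_limit[OF super a_nonneg a_bound]) auto
  have bdd: "bdd_above ((\<lambda>n. a s n / real n) ` {1..})"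
    using a_bound s by (intro bdd_aboveI2[where M = "log_moment + 2"]) (auto simp: divide_simps)
  have aR: "a s n \<le> real n * R" for n
  proof (cases "n = 0")
    case False
    then have "a s n / real n \<le> R" unfolding R_def by (intro cSUP_upper bdd) auto
    then show ?thesis using False by (simp add: field_simps)
  qed (use a_bound[of s 0] s in simp)
  \<comment> \<open>q blocks with the enlarged budget and one block with budget 0 have q n + n
    coordinates and total budget s (q n + n), which is exactly s per coordinate.\<close>
  have enlarged: "a (s * (1 + 1 / real q)) n \<le> real n * (1 + 1 / real q) * R" if q: "0 < q" for n q
  proof -
    let ?s = "s * (1 + 1 / real q)"
    have "real q * a ?s n \<le> bayes_value p (q * n) (real q * (real n * ?s)) + bayes_value p n 0"
      unfolding a_def using bayes_value_mult[of "real n * ?s" q p n] bayes_value_nonneg[of 0 p n] s by simp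
    also have "\<dots> \<le> bayes_value p (q * n + n) (real q * (real n * ?s) + 0)"
      using s by (intro bayes_value_append) auto
    also have "\<dots> = a s (q * n + n)"
    proof -
      have "real q * (1 + 1 / real q) = real q + 1" using q by (simp add: field_simps)
      then have "real q * (real n * ?s) + 0 = real n * s * (real q + 1)" by (metis add.right_neutral mult.assoc mult.left_commute)
      then show ?thesis by (simp add: a_def algebra_simps)
    qed
    also have "\<dots> \<le> real (q * n + n) * R" by (rule aR)
    finally show ?thesis using q by (simp add: field_simps)
  qed
  have R0: "0 \<le> R" using aR[of 1] a_nonneg[of s 1] s by simp
  have upper: "minimax_risk n p \<eta> \<le> ennreal (R + e)" if n: "0 < n" and e: "0 < e" for n e
  proof -
    define q where "q = nat \<lceil>2 * R / e\<rceil> + 1"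
    have q: "0 < q" "R / real q \<le> e / 2"
    proof -
      have "2 * R / e \<le> real q" unfolding q_def by linarith
      then show "R / real q \<le> e / 2" using e by (simp add: q_def field_simps)
    qed (simp add: q_def)
    let ?s = "s * (1 + 1 / real q)"
    have s': "s < ?s" using s q by simp
    have "\<exists>u\<in>log_estimators n. \<forall>\<mu>\<in>budget_set p n (real n * s). total_risk n u \<mu> \<le> ennreal (a ?s n + real n * (e / 2))"
      using n e s s' a_nonneg[of ?s n] bayes_value_upper[of p n "real n * ?s"]
      by (intro minimax_le_bayes[OF p, where c' = "real n * ?s"]) (auto simp: a_def)
    then have "minimax_risk n p \<eta> \<le> ennreal ((a ?s n + real n * (e / 2)) / real n)"
      using minimax_risk_le_total[OF n, of _ p \<eta>] by (auto simp: s_def)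
    also have "(a ?s n + real n * (e / 2)) / real n \<le> (1 + 1 / real q) * R + e / 2"
    proof -
      have "a ?s n / real n \<le> (1 + 1 / real q) * R"
        using enlarged[OF q(1), of n] n by (simp add: pos_divide_le_eq mult_ac)
      then show ?thesis using n by (simp add: add_divide_distrib)
    qed
    also have "\<dots> \<le> R + e"
    proof -
      have "(1 + 1 / real q) * R = R + R / real q" by (simp add: distrib_right)
      then show ?thesis using q(2) by linarith
    qed
    finally show ?thesis by (simp add: ennreal_leI)
  qed
  have fin: "minimax_risk n p \<eta> < \<top>" if "0 < n" for n
    using order_le_less_trans[OF upper[OF that, of 1] ennreal_less_top] by simp
  \<comment> \<open>The upper bound holds at every n, not just in the limit, so the minimax risk is
    squeezed between the Bayes value per coordinate and the limit of the latter.\<close>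
  have up: "enn2real (minimax_risk n p \<eta>) \<le> R" if "0 < n" for n
  proof (rule field_le_epsilon)
    fix e :: real assume "0 < e"
    then show "enn2real (minimax_risk n p \<eta>) \<le> R + e"
      using upper[OF that, of e] R0 by (intro enn2real_leI) auto
  qed
  have low: "a s n / real n \<le> enn2real (minimax_risk n p \<eta>)" if n: "0 < n" for n
  proof -
    have "a s n \<le> real n * enn2real (minimax_risk n p \<eta>)" unfolding a_def
    proof (rule bayes_value_least)
      fix b assume "bayes_lower p n (real n * s) b"
      then have "ennreal (b / real n) \<le> ennreal (enn2real (minimax_risk n p \<eta>))"
        using minimax_risk_ge_bayes[OF n] fin[OF n] by (simp add: s_def)
      then show "b \<le> real n * enn2real (minimax_risk n p \<eta>)"
        using n by (simp add: ennreal_le_iff field_simps)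
    qed (use s in simp)
    then show ?thesis using n by (simp add: field_simps)
  qed
  show thesis
  proof (rule that)
    show "(\<lambda>n. enn2real (minimax_risk n p \<eta>)) \<longlonglongrightarrow> R"
      by (rule tendsto_sandwich[OF eventually_mono[OF eventually_gt_at_top[of 0] low]
          eventually_mono[OF eventually_gt_at_top[of 0] up] lim tendsto_const])
    show "b / real m \<le> R" if "0 < m" "bayes_lower p m (real m * \<eta> powr p) b" for m b
    proof -
      have "b \<le> a s m" using bayes_value_upper[OF that(2)] by (simp add: a_def s_def)
      then show ?thesis using aR[of m] that(1) by (simp add: field_simps)
    qed
  qed (rule fin)
qed

section \<open>Sharp asymptotics as \<eta> tends to 0\<close>

text \<open>Here y = ln (1 / \<eta>), M = y powr (1 - \<delta>) and K = y powr (\<delta> / 2). K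
  tends to infinity, so the truncation event becomes certain, yet K M = y powr (1 - \<delta> / 2) is
  of smaller order than y, so \<open>w\<close> still tends to infinity.\<close>

lemma minimax_risk_limit_lower:
  fixes p \<delta> y :: real
  assumes p: "0 < p" and \<delta>: "0 < \<delta>" "\<delta> < 1" and y: "1 < y"
    and R: "\<And>m b. 0 < m \<Longrightarrow> bayes_lower p m (real m * exp (- y) powr p) b \<Longrightarrow> b / real m \<le> R"
    and big: "1 < ((1 - \<delta>) * ln y) powr p * exp (p * y)"
  defines "w \<equiv> (((1 - \<delta>) * ln y) powr p * exp (p * y) - 1) * exp (- (y powr (\<delta> / 2) * y powr (1 - \<delta>)))"
  shows "((1 - \<delta>) * ln y)\<^sup>2 * (w / (1 + w)) * (1 - exp (- (y powr (\<delta> / 2)))) /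
    (((1 - \<delta>) * ln y) powr p * exp (p * y) + 1) \<le> R"
proof -
  define T where "T = ((1 - \<delta>) * ln y) powr p * exp (p * y)"
  \<comment> \<open>The smallest block whose budget pays for one spike, since \<open>T\<close> times
    \<eta> powr p is the cost of the spike. The final bound replaces m by \<open>T\<close> in
    \<open>w\<close> and by \<open>T + 1\<close> in the denominator, to obtain a smooth function of
    y.\<close>
  define m where "m = nat \<lceil>T\<rceil>"
  define M where "M = y powr (1 - \<delta>)"
  define K where "K = y powr (\<delta> / 2)"
  define v where "v = (real m - 1) * exp (- (K * M))"
  have lnM: "ln M = (1 - \<delta>) * ln y" using y by (simp add: M_def ln_powr)
  have T: "1 < T" using big by (simp add: T_def)
  then have m: "T \<le> real m" "real m \<le> T + 1" "2 \<le> m" unfolding m_def by linarith+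
  have M: "1 < M" using \<delta> y by (simp add: M_def)
  have K: "0 \<le> K" by (simp add: K_def)
  have "T * exp (- y) powr p = ((1 - \<delta>) * ln y) powr p"
    by (simp add: T_def powr_def flip: exp_add)
  then have "ln M powr p \<le> real m * exp (- y) powr p"
    using m(1) mult_right_mono[of T "real m" "exp (- y) powr p"] by (simp add: lnM)
  then have "bayes_lower p m (real m * exp (- y) powr p) ((ln M)\<^sup>2 * (v / (1 + v)) * (1 - exp (- K)))"
    unfolding v_def by (rule bayes_lower_spike[OF M m(3) K])
  then have R': "(ln M)\<^sup>2 * (v / (1 + v)) * (1 - exp (- K)) / real m \<le> R"
    using m(3) by (intro R) auto
  have w: "0 \<le> w" "w \<le> v"
    using T m(1) by (auto simp: w_def v_def T_def K_def M_def intro!: mult_right_mono)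
  have "w / (1 + w) \<le> v / (1 + v)" using w by (simp add: field_simps)
  then have "(ln M)\<^sup>2 * (w / (1 + w)) * (1 - exp (- K)) \<le> (ln M)\<^sup>2 * (v / (1 + v)) * (1 - exp (- K))"
    using K by (intro mult_right_mono[OF mult_left_mono]) auto
  then have "(ln M)\<^sup>2 * (w / (1 + w)) * (1 - exp (- K)) / (T + 1) \<le> (ln M)\<^sup>2 * (v / (1 + v)) * (1 - exp (- K)) / real m"
    using m w K by (intro frac_le) auto
  also note R'
  finally show ?thesis by (simp add: lnM K_def T_def)
qed

text \<open>The numerator behaves like exp (- p y) (ln y) powr (2 - p), where the constant V and the
  factor 2 e p inside the logarithm vanish in the limit because 2 - p > 0. The denominator behaves
  like the same expression with (1 - \<delta>) ln y in place of ln y.\<close>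

lemma risk_ratio_asymptotics:
  fixes p \<delta> V :: real
  assumes "0 < p" "p < 2" "0 < \<delta>" "\<delta> < 1"
  defines "w \<equiv> \<lambda>y. (((1 - \<delta>) * ln y) powr p * exp (p * y) - 1) * exp (- (y powr (\<delta> / 2) * y powr (1 - \<delta>)))"
  shows "((\<lambda>y. exp (- (p * y)) * (2 * V + 1 + ln (2 * exp 1 * p * y) powr (2 - p)) /
     (((1 - \<delta>) * ln y)\<^sup>2 * (w y / (1 + w y)) * (1 - exp (- (y powr (\<delta> / 2)))) /
       (((1 - \<delta>) * ln y) powr p * exp (p * y) + 1)))
     \<longlongrightarrow> (1 - \<delta>) powr p / (1 - \<delta>)\<^sup>2) at_top"
proof -
  have "inverse ((1 - \<delta>)\<^sup>2) * (inverse ((1 - \<delta>) powr p) * (1 - \<delta>) powr p) * (1 - \<delta>) powr p = (1 - \<delta>) powr p / (1 - \<delta>)\<^sup>2"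
    using assms by (simp add: field_simps)
  then show ?thesis using assms(1-4) unfolding w_def by real_asymp
qed

text \<open>Existence of the limit in n is part of the claim. Passing to reals by
  \<open>enn2real\<close> loses nothing, since for n > 0 and \<eta> > 0 both risks are finite, and
  the minimax risk has a positive limit.\<close>

theorem theorem1p2:
  fixes p :: real
  assumes "0 < p" and "p < 2"
  shows "\<exists>L :: real \<Rightarrow> real \<Rightarrow> real.
    (\<forall>\<^sub>F \<eta> in at_right 0. \<forall>t>0.
       (\<lambda>n. enn2real (max_risk n p \<eta> (thresh_est t)) / enn2real (minimax_risk n p \<eta>))
         \<longlonglongrightarrow> L \<eta> t) \<and>
    Liminf (at_right 0) (\<lambda>\<eta>. ereal (INF t\<in>{0<..}. L \<eta> t)) = 1"
proof -
  define ratio where "ratio \<eta> t n = enn2real (max_risk n p \<eta> (thresh_est t)) / enn2real (minimax_risk n p \<eta>)" for \<eta> t n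
  define L where "L \<eta> t = lim (ratio \<eta> t)" for \<eta> t
  have main: "\<exists>R A. 0 < R \<and> (\<forall>m b. 0 < m \<longrightarrow> bayes_lower p m (real m * \<eta> powr p) b \<longrightarrow> b / real m \<le> R) \<and>
      (2 - p \<le> ln t \<longrightarrow> A \<le> exp (- t / (2 * exp 1)) * log_moment + \<eta> powr p * (1 + log_moment + ln t powr (2 - p))) \<and>
      ratio \<eta> t \<longlonglongrightarrow> A / R \<and> L \<eta> t = A / R \<and> 1 \<le> L \<eta> t" if \<eta>: "0 < \<eta>" and t: "0 < t" for \<eta> t
  proof -
    obtain R where R: "(\<lambda>n. enn2real (minimax_risk n p \<eta>)) \<longlonglongrightarrow> R" "\<And>n. 0 < n \<Longrightarrow> minimax_risk n p \<eta> < \<top>"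
      "\<And>m b. 0 < m \<Longrightarrow> bayes_lower p m (real m * \<eta> powr p) b \<Longrightarrow> b / real m \<le> R"
      by (rule minimax_risk_limit[OF assms(1) \<eta>]) blast
    obtain A where A: "(\<lambda>n. enn2real (max_risk n p \<eta> (thresh_est t))) \<longlonglongrightarrow> A"
      "\<And>n. 0 < n \<Longrightarrow> max_risk n p \<eta> (thresh_est t) \<le> ennreal (log_moment + 2 * t)"
      "2 - p \<le> ln t \<Longrightarrow> A \<le> exp (- t / (2 * exp 1)) * log_moment + \<eta> powr p * (1 + log_moment + ln t powr (2 - p))"
      by (rule max_risk_thresh_limit[OF assms t]) blast
    \<comment> \<open>Any fixed spike will do: M = 2 and K = 1, in a block large enough to pay for
      it and with at least two coordinates.\<close>
    have "0 < R"
    proof -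
      define m where "m = nat \<lceil>ln 2 powr p / \<eta> powr p\<rceil> + 2"
      have m: "2 \<le> m" by (simp add: m_def)
      have "ln 2 powr p / \<eta> powr p \<le> real m" unfolding m_def by linarith
      then have "ln 2 powr p \<le> real m * \<eta> powr p" using \<eta> by (simp add: field_simps)
      then have "bayes_lower p m (real m * \<eta> powr p)
          ((ln 2)\<^sup>2 * ((real m - 1) * exp (- (1 * 2)) / (1 + (real m - 1) * exp (- (1 * 2)))) * (1 - exp (- 1)))"
        using m by (intro bayes_lower_spike) auto
      then have "(ln 2)\<^sup>2 * ((real m - 1) * exp (- (1 * 2)) / (1 + (real m - 1) * exp (- (1 * 2)))) * (1 - exp (- 1)) / real m \<le> R"
        using m by (intro R(3)) auto
      moreover have "0 < (ln 2)\<^sup>2 * ((real m - 1) * exp (- (1 * 2)) / (1 + (real m - 1) * exp (- (1 * 2)))) * (1 - exp (- 1 :: real)) / real m"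
        using m by (intro divide_pos_pos mult_pos_pos add_pos_pos) auto
      ultimately show ?thesis by linarith
    qed
    have ratio: "ratio \<eta> t \<longlonglongrightarrow> A / R"
      unfolding ratio_def using R(1) A(1) \<open>0 < R\<close> by (intro tendsto_divide) auto
    then have L: "L \<eta> t = A / R" unfolding L_def by (rule limI)
    have "1 \<le> A / R"
    proof (rule tendsto_lowerbound[OF ratio])
      have "\<forall>\<^sub>F n in sequentially. 0 < enn2real (minimax_risk n p \<eta>)"
        using R(1) \<open>0 < R\<close> by (rule order_tendstoD)
      then show "\<forall>\<^sub>F n in sequentially. 1 \<le> ratio \<eta> t n"
        using eventually_gt_at_top[of 0]
      proof eventually_elim
        case (elim n)
        have "minimax_risk n p \<eta> \<le> max_risk n p \<eta> (thresh_est t)"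
          unfolding minimax_risk_def by (rule INF_lower) (rule thresh_estimator[OF t])
        moreover have "max_risk n p \<eta> (thresh_est t) < \<top>"
          using A(2)[OF elim(2)] by (rule order_le_less_trans) (rule ennreal_less_top)
        ultimately have "enn2real (minimax_risk n p \<eta>) \<le> enn2real (max_risk n p \<eta> (thresh_est t))"
          by (rule enn2real_mono)
        then show ?case using elim(1) by (simp add: ratio_def)
      qed
    qed simp
    then have "1 \<le> L \<eta> t" by (simp only: L)
    with R(3) A(3) ratio L \<open>0 < R\<close> show ?thesis
      by (intro exI[of _ R] exI[of _ A] conjI allI impI)
  qed
  have bdd: "bdd_below (L \<eta> ` {0<..})" if "0 < \<eta>" for \<eta>
    using main[OF that] by (intro bdd_belowI2[where m = 1]) auto
  have pos: "\<forall>\<^sub>F \<eta> :: real in at_right 0. 0 < \<eta>" by (simp add: eventually_at_right_less)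
  have lower: "1 \<le> Liminf (at_right 0) (\<lambda>\<eta>. ereal (INF t\<in>{0<..}. L \<eta> t))"
  proof (rule Liminf_bounded)
    show "\<forall>\<^sub>F \<eta> in at_right 0. 1 \<le> ereal (INF t\<in>{0<..}. L \<eta> t)"
      using pos
    proof eventually_elim
      case (elim \<eta>)
      then have "1 \<le> (INF t\<in>{0<..}. L \<eta> t)" using main by (intro cINF_greatest) (auto simp: gt_ex)
      then show ?case by simp
    qed
  qed
  have upper: "Liminf (at_right 0) (\<lambda>\<eta>. ereal (INF t\<in>{0<..}. L \<eta> t)) \<le> ereal c" if c: "1 < c" for c
  proof -
    \<comment> \<open>The limit ratio for a fixed spike fraction 1 - \<delta> is brought below c
      before \<eta> tends to 0.\<close>
    have "((\<lambda>\<delta>. (1 - \<delta>) powr p / (1 - \<delta>)\<^sup>2) \<longlongrightarrow> (1 - 0) powr p / (1 - 0)\<^sup>2) (at_right 0)"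
      by (intro tendsto_intros) auto
    then have "\<forall>\<^sub>F \<delta> in at_right 0. (1 - \<delta>) powr p / (1 - \<delta>)\<^sup>2 < c"
      using c by (intro order_tendstoD) auto
    moreover have "\<forall>\<^sub>F \<delta> :: real in at_right 0. 0 < \<delta> \<and> \<delta> < 1"
      using eventually_at_right_real[of 0 1] by auto
    ultimately have "\<forall>\<^sub>F \<delta> in at_right 0. (1 - \<delta>) powr p / (1 - \<delta>)\<^sup>2 < c \<and> 0 < \<delta> \<and> \<delta> < 1"
      by (rule eventually_conj)
    then obtain \<delta> where \<delta>: "(1 - \<delta>) powr p / (1 - \<delta>)\<^sup>2 < c" "0 < \<delta>" "\<delta> < 1"
      using eventually_happens'[OF trivial_limit_at_right_real] by fastforce
    define T where "T y = ((1 - \<delta>) * ln y) powr p * exp (p * y)" for y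
    define w where "w y = (T y - 1) * exp (- (y powr (\<delta> / 2) * y powr (1 - \<delta>)))" for y
    define U where "U y = exp (- (p * y)) * (2 * log_moment + 1 + ln (2 * exp 1 * p * y) powr (2 - p))" for y
    define B where "B y = ((1 - \<delta>) * ln y)\<^sup>2 * (w y / (1 + w y)) * (1 - exp (- (y powr (\<delta> / 2)))) / (T y + 1)" for y
    have "((\<lambda>y. U y / B y) \<longlongrightarrow> (1 - \<delta>) powr p / (1 - \<delta>)\<^sup>2) at_top"
      unfolding U_def B_def w_def T_def by (rule risk_ratio_asymptotics[OF assms \<delta>(2,3)])
    then have "\<forall>\<^sub>F y in at_top. U y / B y < c" using \<delta>(1) by (rule order_tendstoD)
    moreover have "\<forall>\<^sub>F y in at_top. 1 < T y" using assms \<delta>(2,3) unfolding T_def by real_asymp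
    moreover have "\<forall>\<^sub>F y in at_top. 2 - p \<le> ln (2 * exp 1 * p * y)" using assms by real_asymp
    moreover have "\<forall>\<^sub>F y :: real in at_top. 1 < y" by (rule eventually_gt_at_top)
    ultimately have "\<forall>\<^sub>F y in at_top. U y / B y < c \<and> 1 < T y \<and> 2 - p \<le> ln (2 * exp 1 * p * y) \<and> 1 < y"
      by (intro eventually_conj)
    moreover have "filterlim (\<lambda>\<eta> :: real. ln (1 / \<eta>)) at_top (at_right 0)" by real_asymp
    ultimately have "\<forall>\<^sub>F \<eta> in at_right 0. U (ln (1 / \<eta>)) / B (ln (1 / \<eta>)) < c \<and> 1 < T (ln (1 / \<eta>)) \<and>
        2 - p \<le> ln (2 * exp 1 * p * ln (1 / \<eta>)) \<and> 1 < ln (1 / \<eta>)"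
      by (rule eventually_compose_filterlim)
    then have "\<forall>\<^sub>F \<eta> in at_right 0. ereal (INF t\<in>{0<..}. L \<eta> t) \<le> ereal c"
      using pos
    proof eventually_elim
      case (elim \<eta>)
      define y where "y = ln (1 / \<eta>)"
      \<comment> \<open>Chosen so that exp (- t / (2 e)) equals \<eta> powr p: the false alarms then
        cost a constant times \<eta> powr p, of lower order than the missed spikes. They account for
        one of the two copies of \<open>log_moment\<close> in \<open>U\<close>.\<close>
      define t where "t = 2 * exp 1 * p * y"
      have y: "U y / B y < c" "1 < T y" "2 - p \<le> ln t" "1 < y" using elim by (auto simp: y_def t_def)
      have \<eta>: "\<eta> = exp (- y)" using elim(2) by (simp add: y_def ln_div)
      have t: "0 < t" using y assms by (simp add: t_def)
      obtain R A where RA: "0 < R" "\<And>m b. 0 < m \<Longrightarrow> bayes_lower p m (real m * \<eta> powr p) b \<Longrightarrow> b / real m \<le> R"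
        "A \<le> exp (- t / (2 * exp 1)) * log_moment + \<eta> powr p * (1 + log_moment + ln t powr (2 - p))" "L \<eta> t = A / R"
        using main[OF elim(2) t] y(3) by blast
      have "B y \<le> R"
        unfolding B_def w_def T_def
        by (rule minimax_risk_limit_lower[OF assms(1) \<delta>(2,3) y(4)]) (use RA(2) y(2) in \<open>auto simp: \<eta> T_def\<close>)
      moreover have "0 < B y"
        unfolding B_def using y \<delta>
        by (intro divide_pos_pos mult_pos_pos add_pos_pos) (auto simp: w_def)
      moreover have "A \<le> U y"
      proof -
        have "exp (- t / (2 * exp 1)) = exp (- (p * y))" by (simp add: t_def)
        moreover have "\<eta> powr p = exp (- (p * y))" by (simp add: \<eta> powr_def)
        ultimately show ?thesis using RA(3) by (simp add: U_def t_def algebra_simps)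
      qed
      moreover have "0 \<le> U y" using log_moment_nonneg by (simp add: U_def)
      ultimately have "A / R \<le> U y / B y" by (intro frac_le) auto
      then have "L \<eta> t \<le> c" using RA(4) y(1) by simp
      moreover have "(INF t\<in>{0<..}. L \<eta> t) \<le> L \<eta> t" using t by (intro cINF_lower bdd elim(2)) auto
      ultimately show ?case by simp
    qed
    \<comment> \<open>The bound holds for all small \<eta>, so even the upper limit is at most
      c.\<close>
    then have "Limsup (at_right 0) (\<lambda>\<eta>. ereal (INF t\<in>{0<..}. L \<eta> t)) \<le> ereal c"
      by (rule Limsup_bounded)
    then show ?thesis
      using Liminf_le_Limsup[OF trivial_limit_at_right_real] order_trans by blast
  qed
  have "Liminf (at_right 0) (\<lambda>\<eta>. ereal (INF t\<in>{0<..}. L \<eta> t)) \<le> 1"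
  proof (rule dense_ge)
    fix x :: ereal assume "1 < x"
    then show "Liminf (at_right 0) (\<lambda>\<eta>. ereal (INF t\<in>{0<..}. L \<eta> t)) \<le> x"
      using upper by (cases x) auto
  qed
  then have "Liminf (at_right 0) (\<lambda>\<eta>. ereal (INF t\<in>{0<..}. L \<eta> t)) = 1"
    using lower by (rule antisym)
  moreover have "\<forall>\<^sub>F \<eta> in at_right 0. \<forall>t>0. ratio \<eta> t \<longlonglongrightarrow> L \<eta> t"
    using pos by eventually_elim (use main in metis)
  ultimately show ?thesis unfolding ratio_def by blast
qed

end
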